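(* For any $\bm{C}\in\mathbb{R}^{n\times K}$, the projection problem $$\mathcal{T}(\bm{C})=\operatorname{argmin}\{\|\bm{H}-\bm{C}\|_F:\ \bm{H}\in\mathcal{H}\}$$ is equivalent to a minimum-cost assignment problem, which can be solved in $\mathcal{O}(K^2n\log n)$ time.
   Context: $K\ge2$ and $m\ge1$ are integers, $n=mK$, $\bm{1}_d$ is the all-one vector in $\mathbb{R}^d$, $\|\cdot\|_F$ is the Frobenius norm, and $\mathcal{H}=\{\bm{H}\in\{0,1\}^{n\times K}:\bm{H}\bm{1}_K=\bm{1}_n,\ \bm{H}^T\bm{1}_n=m\bm{1}_K\}$. Minimum-cost assignment problem: let $\Gamma=(U,V,E)$ be the complete bipartite graph with parts $U=\{u_1,\dots,u_n\}$ and $V=\{v_1,\dots,v_K\}$ and edge set $E$. Given a cost matrix $\bm{D}\in\mathbb{R}^{n\times K}$, where $d_{ik}$ is the cost of the edge $e(u_i,v_k)\in E$, and a vector $\bm{\pi}=(\pi_1,\dots,\pi_K)$ of non-negative integers with $\sum_{k=1}^K\pi_k=n$, the minimum-cost $\bm{\pi}$-assignment problem is to find a subgraph $G$ of $\Gamma$ such that (i) the node set of $G$ is $U\cup V$, every $u_i\in U$ has degree $1$ in $G$, and every $v_k\in V$ has degree $\pi_k$ in $G$, and (ii) the total cost $\sum_{e(u_i,v_k)\in E(G)}d_{ik}$ is minimized, where $E(G)$ is the edge set of $G$. *)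

theory Defs
  imports Complex_Main "Jordan_Normal_Form.Matrix"
begin

section \<open>The projection problem\<close>

definition ones :: "nat \<Rightarrow> real vec" where
  "ones d = vec d (\<lambda>_. 1)"

definition frob_norm :: "real mat \<Rightarrow> real" where
  "frob_norm A = sqrt (\<Sum>i<dim_row A. \<Sum>j<dim_col A. (A $$ (i, j))\<^sup>2)"

definition balanced_mats :: "nat \<Rightarrow> nat \<Rightarrow> real mat set" where
  "balanced_mats m K = {H \<in> carrier_mat (m * K) K.
     (\<forall>i<m * K. \<forall>k<K. H $$ (i, k) \<in> {0, 1}) \<and>
     H *\<^sub>v ones K = ones (m * K) \<and>
     transpose_mat H *\<^sub>v ones (m * K) = real m \<cdot>\<^sub>v ones K}"

definition projections :: "nat \<Rightarrow> nat \<Rightarrow> real mat \<Rightarrow> real mat set" where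
  "projections m K C =
     {H. is_arg_min (\<lambda>H. frob_norm (H - C)) (\<lambda>H. H \<in> balanced_mats m K) H}"

section \<open>The minimum-cost assignment problem\<close>

text \<open>
  The vertices are \<open>Inl i\<close> (for $u_{i+1}$) and \<open>Inr k\<close> (for $v_{k+1}$). A graph is a pair of a
  vertex set and a set of undirected edges, an edge being the set of its two endpoints.
\<close>

type_synonym vertex = "nat + nat"
type_synonym graph = "vertex set \<times> vertex set set"

definition verts :: "graph \<Rightarrow> vertex set" where
  "verts G = fst G"

definition edges :: "graph \<Rightarrow> vertex set set" where
  "edges G = snd G"

definition complete_bip :: "nat \<Rightarrow> nat \<Rightarrow> graph" where
  "complete_bip n K = (Inl ` {..<n} \<union> Inr ` {..<K}, {{Inl i, Inr k} |i k. i < n \<and> k < K})"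

definition is_subgraph :: "graph \<Rightarrow> graph \<Rightarrow> bool" where
  "is_subgraph G \<Gamma> \<longleftrightarrow> verts G \<subseteq> verts \<Gamma> \<and> edges G \<subseteq> edges \<Gamma> \<and> \<Union> (edges G) \<subseteq> verts G"

definition vertex_degree :: "graph \<Rightarrow> vertex \<Rightarrow> nat" where
  "vertex_degree G v = card {e \<in> edges G. v \<in> e}"

definition assignments :: "nat \<Rightarrow> nat \<Rightarrow> nat vec \<Rightarrow> graph set" where
  "assignments n K \<pi> = {G. is_subgraph G (complete_bip n K) \<and>
     verts G = Inl ` {..<n} \<union> Inr ` {..<K} \<and>
     (\<forall>i<n. vertex_degree G (Inl i) = 1) \<and> (\<forall>k<K. vertex_degree G (Inr k) = \<pi> $ k)}"

definition assignment_cost :: "real mat \<Rightarrow> graph \<Rightarrow> real" where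
  "assignment_cost D G =
     (\<Sum>(i, k) \<in> {(i, k). i < dim_row D \<and> k < dim_col D \<and> {Inl i, Inr k} \<in> edges G}. D $$ (i, k))"

definition min_cost_assignments :: "real mat \<Rightarrow> nat vec \<Rightarrow> graph set" where
  "min_cost_assignments D \<pi> =
     {G. is_arg_min (assignment_cost D) (\<lambda>G. G \<in> assignments (dim_row D) (dim_col D) \<pi>) G}"

definition graph_of_mat :: "real mat \<Rightarrow> graph" where
  "graph_of_mat H =
     (Inl ` {..<dim_row H} \<union> Inr ` {..<dim_col H},
      {{Inl i, Inr k} |i k. i < dim_row H \<and> k < dim_col H \<and> H $$ (i, k) = 1})"

text \<open>
  Two minimization problems are equivalent along \<open>\<phi>\<close> if \<open>\<phi>\<close> identifies their feasible sets and
  the objectives order corresponding feasible points in the same way (so that, in particular,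
  \<open>\<phi>\<close> also identifies the optimal solutions).
\<close>

definition equivalent_min_problems ::
    "('a \<Rightarrow> 'b) \<Rightarrow> ('a \<Rightarrow> real) \<Rightarrow> 'a set \<Rightarrow> ('b \<Rightarrow> real) \<Rightarrow> 'b set \<Rightarrow> bool" where
  "equivalent_min_problems \<phi> f S g T \<longleftrightarrow>
     bij_betw \<phi> S T \<and>
     (\<forall>x\<in>S. \<forall>y\<in>S. f x \<le> f y \<longleftrightarrow> g (\<phi> x) \<le> g (\<phi> y))"

section \<open>A real RAM\<close>

text \<open>
  Running times refer to the following deterministic imperative language. The memory consists of
  arrays of natural numbers and arrays of real numbers; a scalar is an array used at index 0 only.
  Every operation and every memory access takes one time unit. Real arithmetic and comparison are
  exact, but there is no way to convert a real number into a natural number. As in a word RAM,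
  only natural numbers up to a word bound \<open>W\<close> can be stored (an execution that attempts to store a
  larger one has no outcome), so that arithmetic on natural numbers cannot be abused to compute
  with huge numbers at unit cost.
\<close>

type_synonym memory = "(string \<Rightarrow> nat \<Rightarrow> nat) \<times> (string \<Rightarrow> nat \<Rightarrow> real)"

datatype nexp =
    NConst nat
  | NRead string nexp
  | NAdd nexp nexp
  | NSub nexp nexp
  | NMul nexp nexp
  | NDiv nexp nexp

datatype rexp =
    ROfNat nexp
  | RRead string nexp
  | RAdd rexp rexp
  | RSub rexp rexp
  | RMul rexp rexp
  | RDiv rexp rexp

datatype bexp =
    NLess nexp nexp
  | RLess rexp rexp
  | BNot bexp
  | BAnd bexp bexp

datatype com =
    Skip
  | NStore string nexp nexp
  | RStore string nexp rexp
  | Seq com com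
  | Cond bexp com com
  | While bexp com

primrec nval :: "memory \<Rightarrow> nexp \<Rightarrow> nat" where
  "nval s (NConst a) = a"
| "nval s (NRead x e) = fst s x (nval s e)"
| "nval s (NAdd e f) = nval s e + nval s f"
| "nval s (NSub e f) = nval s e - nval s f"
| "nval s (NMul e f) = nval s e * nval s f"
| "nval s (NDiv e f) = nval s e div nval s f"

primrec rval :: "memory \<Rightarrow> rexp \<Rightarrow> real" where
  "rval s (ROfNat e) = real (nval s e)"
| "rval s (RRead x e) = snd s x (nval s e)"
| "rval s (RAdd e f) = rval s e + rval s f"
| "rval s (RSub e f) = rval s e - rval s f"
| "rval s (RMul e f) = rval s e * rval s f"
| "rval s (RDiv e f) = rval s e / rval s f"

primrec bval :: "memory \<Rightarrow> bexp \<Rightarrow> bool" where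
  "bval s (NLess e f) \<longleftrightarrow> nval s e < nval s f"
| "bval s (RLess e f) \<longleftrightarrow> rval s e < rval s f"
| "bval s (BNot b) \<longleftrightarrow> \<not> bval s b"
| "bval s (BAnd b c) \<longleftrightarrow> bval s b \<and> bval s c"

primrec ntime :: "nexp \<Rightarrow> nat" where
  "ntime (NConst a) = 1"
| "ntime (NRead x e) = 1 + ntime e"
| "ntime (NAdd e f) = 1 + ntime e + ntime f"
| "ntime (NSub e f) = 1 + ntime e + ntime f"
| "ntime (NMul e f) = 1 + ntime e + ntime f"
| "ntime (NDiv e f) = 1 + ntime e + ntime f"

primrec rtime :: "rexp \<Rightarrow> nat" where
  "rtime (ROfNat e) = 1 + ntime e"
| "rtime (RRead x e) = 1 + ntime e"
| "rtime (RAdd e f) = 1 + rtime e + rtime f"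
| "rtime (RSub e f) = 1 + rtime e + rtime f"
| "rtime (RMul e f) = 1 + rtime e + rtime f"
| "rtime (RDiv e f) = 1 + rtime e + rtime f"

primrec btime :: "bexp \<Rightarrow> nat" where
  "btime (NLess e f) = 1 + ntime e + ntime f"
| "btime (RLess e f) = 1 + rtime e + rtime f"
| "btime (BNot b) = 1 + btime b"
| "btime (BAnd b c) = 1 + btime b + btime c"

definition nstore :: "string \<Rightarrow> nat \<Rightarrow> nat \<Rightarrow> memory \<Rightarrow> memory" where
  "nstore x a v s = ((fst s)(x := (fst s x)(a := v)), snd s)"

definition rstore :: "string \<Rightarrow> nat \<Rightarrow> real \<Rightarrow> memory \<Rightarrow> memory" where
  "rstore x a v s = (fst s, (snd s)(x := (snd s x)(a := v)))"

text \<open>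
  \<open>exec W c s t s'\<close>: with word bound \<open>W\<close>, the program \<open>c\<close> started in memory \<open>s\<close> terminates
  after \<open>t\<close> time units in memory \<open>s'\<close>.
\<close>

inductive exec :: "nat \<Rightarrow> com \<Rightarrow> memory \<Rightarrow> nat \<Rightarrow> memory \<Rightarrow> bool" for W where
  Skip: "exec W Skip s 1 s"
| NStore: "nval s e \<le> W \<Longrightarrow>
    exec W (NStore x a e) s (1 + ntime a + ntime e) (nstore x (nval s a) (nval s e) s)"
| RStore: "exec W (RStore x a e) s (1 + ntime a + rtime e) (rstore x (nval s a) (rval s e) s)"
| Seq: "exec W c s t s' \<Longrightarrow> exec W d s' u s'' \<Longrightarrow> exec W (Seq c d) s (t + u) s''"
| CondTrue: "bval s b \<Longrightarrow> exec W c s t s' \<Longrightarrow> exec W (Cond b c d) s (1 + btime b + t) s'"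
| CondFalse: "\<not> bval s b \<Longrightarrow> exec W d s t s' \<Longrightarrow> exec W (Cond b c d) s (1 + btime b + t) s'"
| WhileFalse: "\<not> bval s b \<Longrightarrow> exec W (While b c) s (1 + btime b) s"
| WhileTrue: "bval s b \<Longrightarrow> exec W c s t s' \<Longrightarrow> exec W (While b c) s' u s'' \<Longrightarrow>
    exec W (While b c) s (1 + btime b + t + u) s''"

text \<open>
  Inputs and outputs: matrices are stored row by row, the output matrix being a 0-1 matrix
  in the natural-number array \<open>out\<close>. All memory cells that do not hold the input are initially 0.
\<close>

definition assignment_input :: "real mat \<Rightarrow> nat vec \<Rightarrow> memory" where
  "assignment_input D \<pi> =
     (\<lambda>x a. if x = ''n'' \<and> a = 0 then dim_row D
            else if x = ''K'' \<and> a = 0 then dim_col D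
            else if x = ''pi'' \<and> a < dim_col D then \<pi> $ a
            else 0,
      \<lambda>x a. if x = ''D'' \<and> a < dim_row D * dim_col D
            then D $$ (a div dim_col D, a mod dim_col D) else 0)"

definition projection_input :: "nat \<Rightarrow> nat \<Rightarrow> real mat \<Rightarrow> memory" where
  "projection_input m K C =
     (\<lambda>x a. if x = ''m'' \<and> a = 0 then m
            else if x = ''K'' \<and> a = 0 then K
            else 0,
      \<lambda>x a. if x = ''C'' \<and> a < m * K * K then C $$ (a div K, a mod K) else 0)"

definition output_mat :: "nat \<Rightarrow> nat \<Rightarrow> memory \<Rightarrow> real mat" where
  "output_mat n K s = mat n K (\<lambda>(i, k). real (fst s ''out'' (i * K + k)))"

text \<open>
  A single program has to work for all sizes, and the word bound has to be polynomial in \<open>n\<close>,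
  i.e. natural numbers have \<open>O(log n)\<close> bits. Since \<open>2 \<le> K \<le> n\<close>, all inputs and indices
  fit for a suitable exponent.
\<close>

definition assignment_solvable_in_time :: "(nat \<Rightarrow> nat \<Rightarrow> real) \<Rightarrow> bool" where
  "assignment_solvable_in_time T \<longleftrightarrow>
     (\<exists>p c d. \<forall>K m n D \<pi>. K \<ge> 2 \<longrightarrow> m \<ge> 1 \<longrightarrow> n = m * K \<longrightarrow>
        D \<in> carrier_mat n K \<longrightarrow> \<pi> \<in> carrier_vec K \<longrightarrow> (\<Sum>k<K. \<pi> $ k) = n \<longrightarrow>
        (\<exists>t s. exec (n ^ d) p (assignment_input D \<pi>) t s \<and> real t \<le> c * T n K \<and>
           graph_of_mat (output_mat n K s) \<in> min_cost_assignments D \<pi>))"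

definition projection_solvable_in_time :: "(nat \<Rightarrow> nat \<Rightarrow> real) \<Rightarrow> bool" where
  "projection_solvable_in_time T \<longleftrightarrow>
     (\<exists>p c d. \<forall>K m n C. K \<ge> 2 \<longrightarrow> m \<ge> 1 \<longrightarrow> n = m * K \<longrightarrow> C \<in> carrier_mat n K \<longrightarrow>
        (\<exists>t s. exec (n ^ d) p (projection_input m K C) t s \<and> real t \<le> c * T n K \<and>
           output_mat n K s \<in> projections m K C))"

end

theory Submission
  imports Defs
begin

text \<open>
  Expanding the square shows that \<open>(frob_norm (H - C))\<^sup>2\<close> is a constant plus twice the cost of the
  assignment encoded by \<open>H\<close> with respect to the cost matrix \<open>- C\<close>, which gives the equivalence.

  The algorithm inserts the nodes $u_i$ ("rows") one after another and maintains potentials \<open>y\<close> on the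
  columns such that every row inserted so far sits in a column minimizing \<open>d r k - y k\<close>. Summing these
  inequalities shows that such an assignment is optimal as soon as all columns are filled, so that
  nothing has to be required of the potentials of columns that are not yet full. To insert a row, Dijkstra's
  algorithm computes the distances \<open>L\<close> from it to all columns, where moving a row \<open>r\<close> from column
  \<open>j\<close> to column \<open>k\<close> has length \<open>d r k - d r j\<close>, and \<open>y\<close> makes the reduced lengths nonnegative. Then \<open>L\<close> is
  the new potential, and rows are shifted along a shortest path to an arbitrary column with
  spare capacity. The cheapest row to move from \<open>j\<close> to \<open>k\<close> is the root of a tournament tree
  for the pair \<open>(j, k)\<close>. Per insertion, Dijkstra's algorithm costs \<open>O(K\<^sup>2)\<close>, and at most \<open>K\<close> rows move,
  each of which changes one leaf in \<open>2 K\<close> trees of depth \<open>O(log n)\<close>.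
\<close>

section \<open>Total correctness with running times\<close>

text \<open>This is the method of successive shortest paths for a transportation problem with few
  sinks. A search through the residual graph on all \<open>n + K\<close> nodes would cost time
  linear in \<open>n\<close> per insertion. Here rows are only arcs between columns, so the search
  sees \<open>K\<close> nodes, and the trees replace the scan over the rows of a column. Moves can
  have negative length, which is why Dijkstra's algorithm needs potentials. That \<open>L\<close>
  can replace \<open>y\<close> has two reasons: the triangle inequality for \<open>L\<close> is
  exactly feasibility for the rows that stay, and equality along shortest-path arcs makes every row
  that moves optimal in its new column. The mathematics is kept in lemmas about plain functions
  (\<open>path_inv_step\<close>, \<open>labels_step\<close>, \<open>labels_final\<close>); the
  \<open>runs\<close> lemmas connect them with the memory and the clock. A number \<open>l\<close>
  with \<open>n < 2 ^ l\<close> stands for the logarithm until it is compared with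
  \<open>ln n\<close> at the end.\<close>

primrec nwrites :: "com \<Rightarrow> string set" where
  "nwrites Skip = {}"
| "nwrites (NStore x a e) = {x}"
| "nwrites (RStore x a e) = {}"
| "nwrites (Seq c d) = nwrites c \<union> nwrites d"
| "nwrites (Cond b c d) = nwrites c \<union> nwrites d"
| "nwrites (While b c) = nwrites c"

primrec rwrites :: "com \<Rightarrow> string set" where
  "rwrites Skip = {}"
| "rwrites (NStore x a e) = {}"
| "rwrites (RStore x a e) = {x}"
| "rwrites (Seq c d) = rwrites c \<union> rwrites d"
| "rwrites (Cond b c d) = rwrites c \<union> rwrites d"
| "rwrites (While b c) = rwrites c"

text \<open>Frames are read off the syntax, one whole array at a time. Since \<open>runs_Seq\<close>
  and \<open>runs_conseq\<close> pass the frame on, a specification needs to mention only what its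
  program changes.\<close>

definition frame :: "com \<Rightarrow> memory \<Rightarrow> memory \<Rightarrow> bool" where
  "frame c s s' \<longleftrightarrow> (\<forall>x. x \<notin> nwrites c \<longrightarrow> fst s' x = fst s x) \<and> (\<forall>x. x \<notin> rwrites c \<longrightarrow> snd s' x = snd s x)"

lemma fst_nstore [simp]: "fst (nstore x a v s) y = (if y = x then (fst s x)(a := v) else fst s y)"
  and snd_nstore [simp]: "snd (nstore x a v s) = snd s"
  and snd_rstore [simp]: "snd (rstore x a u s) y = (if y = x then (snd s x)(a := u) else snd s y)"
  and fst_rstore [simp]: "fst (rstore x a u s) = fst s"
  by (auto simp: nstore_def rstore_def)

lemma exec_frame: "exec W c s t s' \<Longrightarrow> frame c s s'"
  by (induction rule: exec.induct) (auto simp: frame_def nstore_def rstore_def)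

text \<open>A bound instead of the exact time lets both branches of a conditional share one budget.
  Existence of an execution includes that no stored natural number exceeds \<open>W\<close>, since
  an overflow has no derivation.\<close>

definition runs :: "nat \<Rightarrow> com \<Rightarrow> memory \<Rightarrow> nat \<Rightarrow> (memory \<Rightarrow> bool) \<Rightarrow> bool" where
  "runs W c s T Q \<longleftrightarrow> (\<exists>t s'. exec W c s t s' \<and> t \<le> T \<and> Q s')"

lemma runs_conseq:
  assumes "runs W c s T Q" "T \<le> T'" "\<And>s'. Q s' \<Longrightarrow> frame c s s' \<Longrightarrow> Q' s'"
  shows "runs W c s T' Q'"
  using assms exec_frame unfolding runs_def by (meson order_trans)

lemma runs_Skip: "runs W Skip s T Q" if "1 \<le> T" "Q s"
  using that exec.Skip unfolding runs_def by blast

lemma runs_NStore: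
  assumes "nval s e \<le> W" "1 + ntime a + ntime e \<le> T" "Q (nstore x (nval s a) (nval s e) s)"
  shows "runs W (NStore x a e) s T Q"
  using assms exec.NStore unfolding runs_def by blast

lemma runs_RStore:
  assumes "1 + ntime a + rtime e \<le> T" "Q (rstore x (nval s a) (rval s e) s)"
  shows "runs W (RStore x a e) s T Q"
  using assms exec.RStore unfolding runs_def by blast

lemma runs_Seq:
  assumes "runs W c s T P" "\<And>s'. P s' \<Longrightarrow> frame c s s' \<Longrightarrow> runs W d s' U Q" "T + U \<le> V"
  shows "runs W (Seq c d) s V Q"
proof -
  obtain t s' where 1: "exec W c s t s'" "t \<le> T" "P s'"
    using assms(1) unfolding runs_def by blast
  then obtain u s'' where 2: "exec W d s' u s''" "u \<le> U" "Q s''"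
    using assms(2) exec_frame unfolding runs_def by blast
  show ?thesis
    unfolding runs_def using exec.Seq[OF 1(1) 2(1)] 1 2 assms(3) by (meson add_mono order_trans)
qed

lemma runs_Cond:
  assumes "1 + btime b \<le> T"
    and "bval s b \<Longrightarrow> runs W c s (T - (1 + btime b)) Q"
    and "\<not> bval s b \<Longrightarrow> runs W d s (T - (1 + btime b)) Q"
  shows "runs W (Cond b c d) s T Q"
proof (cases "bval s b")
  case True
  then obtain t s' where 1: "exec W c s t s'" "t \<le> T - (1 + btime b)" "Q s'"
    using assms(2) unfolding runs_def by blast
  show ?thesis
    unfolding runs_def using exec.CondTrue[OF True 1(1), of d] 1 assms(1) by fastforce
next
  case False
  then obtain t s' where 1: "exec W d s t s'" "t \<le> T - (1 + btime b)" "Q s'"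
    using assms(3) unfolding runs_def by blast
  show ?thesis
    unfolding runs_def using exec.CondFalse[OF False 1(1), of c] 1 assms(1) by fastforce
qed

text \<open>In the next two rules the time budget is passed on to the remaining program, so that
  straight-line code can be executed symbolically by the simplifier.\<close>

lemma runs_NStore_Seq:
  assumes "nval s e \<le> W" "1 + ntime a + ntime e \<le> T"
    "runs W d (nstore x (nval s a) (nval s e) s) (T - (1 + ntime a + ntime e)) Q"
  shows "runs W (Seq (NStore x a e) d) s T Q"
  by (rule runs_Seq[where T = "1 + ntime a + ntime e" and P = "(=) (nstore x (nval s a) (nval s e) s)", OF runs_NStore])
    (use assms in auto)

lemma runs_RStore_Seq:
  assumes "1 + ntime a + rtime e \<le> T"
    "runs W d (rstore x (nval s a) (rval s e) s) (T - (1 + ntime a + rtime e)) Q"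
  shows "runs W (Seq (RStore x a e) d) s T Q"
  by (rule runs_Seq[where T = "1 + ntime a + rtime e" and P = "(=) (rstore x (nval s a) (rval s e) s)", OF runs_RStore])
    (use assms in auto)

lemmas runs_intros = runs_Skip runs_NStore runs_RStore runs_NStore_Seq runs_RStore_Seq runs_Cond

text \<open>The variant \<open>l\<close> is a parameter of the invariant, not a function of the
  memory: it will be instantiated with quantities that no cell holds, such as the number of tree
  levels left or a bound on a rank \<open>dn\<close>.\<close>

lemma runs_While:
  assumes "I l s"
    and step: "\<And>l s. I l s \<Longrightarrow> bval s b \<Longrightarrow> 0 < l \<and> runs W c s T (I (l - 1))"
  shows "runs W (While b c) s (l * (1 + btime b + T) + 1 + btime b) (\<lambda>s'. \<not> bval s' b \<and> (\<exists>l. I l s'))"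
  using assms(1)
proof (induction l arbitrary: s)
  case 0
  then have "\<not> bval s b" using step by blast
  then show ?case
    unfolding runs_def using exec.WhileFalse 0 by fastforce
next
  case (Suc l)
  show ?case
  proof (cases "bval s b")
    case False
    then have "exec W (While b c) s (1 + btime b) s"
      by (rule exec.WhileFalse)
    then show ?thesis
      unfolding runs_def using False Suc.prems by (intro exI[of _ "1 + btime b"] exI[of _ s]) auto
  next
    case True
    then obtain t s' where 1: "exec W c s t s'" "t \<le> T" "I l s'"
      using step[OF Suc.prems] unfolding runs_def by auto
    obtain u s'' where 2: "exec W (While b c) s' u s''" "u \<le> l * (1 + btime b + T) + 1 + btime b"
      "\<not> bval s'' b \<and> (\<exists>l. I l s'')"
      using Suc.IH[OF 1(3)] unfolding runs_def by blast
    show ?thesis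
      unfolding runs_def using exec.WhileTrue[OF True 1(1) 2(1)] 1 2 by fastforce
  qed
qed

abbreviation sc :: "string \<Rightarrow> nexp" where
  "sc x \<equiv> NRead x (NConst 0)"

abbreviation st :: "string \<Rightarrow> nexp \<Rightarrow> com" where
  "st x e \<equiv> NStore x (NConst 0) e"

definition For :: "string \<Rightarrow> string \<Rightarrow> com \<Rightarrow> com" where
  "For x y c = Seq (st x (NConst 0)) (While (NLess (sc x) (sc y)) (Seq c (st x (NAdd (sc x) (NConst 1)))))"

lemma writes_For [simp]: "nwrites (For x y c) = insert x (nwrites c)" "rwrites (For x y c) = rwrites c"
  by (auto simp: For_def)

text \<open>Each round adds 6 units for the test and 6 for the increment, hence
  \<open>T + 12\<close>; the 10 covers the initial store (3) and the failing last test (6). The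
  invariant is asserted after the counter has been stored, and \<open>N \<le> W\<close> because the
  counter reaches \<open>N\<close>.\<close>

lemma runs_For:
  assumes init: "I 0 (nstore x 0 0 s)"
    and step: "\<And>k s. k < N \<Longrightarrow> I k s \<Longrightarrow> fst s x 0 = k \<Longrightarrow> runs W c s T (\<lambda>s'. I (Suc k) (nstore x 0 (Suc k) s'))"
    and bound: "fst s y 0 = N" "x \<noteq> y" "y \<notin> nwrites c" "x \<notin> nwrites c" "N \<le> W"
    and time: "N * (T + 12) + 10 \<le> V"
  shows "runs W (For x y c) s V (I N)"
proof -
  define J where "J l s \<longleftrightarrow> (\<exists>k\<le>N. I k s \<and> fst s x 0 = k \<and> fst s y 0 = N \<and> l = N - k)" for l s
  let ?d = "Seq c (st x (NAdd (sc x) (NConst 1)))"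
  let ?b = "NLess (sc x) (sc y)"
  have *: "0 < l \<and> runs W ?d s (T + 6) (J (l - 1))" if "J l s" "bval s ?b" for l s
  proof -
    from that obtain k where k: "k < N" "I k s" "fst s x 0 = k" "fst s y 0 = N" "l = N - k"
      by (auto simp: J_def)
    have "runs W ?d s (T + 6) (J (l - 1))"
      by (rule runs_Seq[OF step[OF k(1-3)], where U = 6])
        (use k assms(3-7) in \<open>auto simp: frame_def J_def intro!: runs_intros\<close>)
    with k show ?thesis by auto
  qed
  have "J N (nstore x 0 0 s)"
    using assms by (auto simp: J_def)
  from runs_While[where I = J, OF this *]
  have "runs W (While ?b ?d) (nstore x 0 0 s) (N * (1 + btime ?b + (T + 6)) + 1 + btime ?b)
      (\<lambda>s'. \<not> bval s' ?b \<and> (\<exists>l. J l s'))"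
    by blast
  then have "runs W (While ?b ?d) (nstore x 0 0 s) (N * (T + 12) + 6) (I N)"
    by (rule runs_conseq) (auto simp: J_def)
  then have "runs W (While ?b ?d) (nstore x 0 0 s) (V - 3) (I N)"
    by (rule runs_conseq) (use time in auto)
  then show ?thesis
    unfolding For_def using time by (intro runs_NStore_Seq) (auto simp: numeral_3_eq_3)
qed

section \<open>Tournament trees\<close>

text \<open>The winner of a match between two children. The nested negations copy the guard of
  \<open>upd_step\<close>, where a disjunction has to be expressed by \<open>BNot\<close> and
  \<open>BAnd\<close>. Ties keep the left child \<open>x\<close>.\<close>

definition better :: "(nat \<Rightarrow> real) \<Rightarrow> nat \<Rightarrow> nat \<Rightarrow> nat" where
  "better f x z = (if 0 < z \<and> \<not> (0 < x \<and> \<not> f (z - 1) < f (x - 1)) then z else x)"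

text \<open>The heap numbering works without \<open>n\<close> being a power of two: every node
  \<open>q\<close> with \<open>2 \<le> q < 2 * n\<close> has the inner node
  \<open>q div 2 < n\<close> as its parent. On the way up from \<open>q\<close> to the root the
  value of the winner never increases.\<close>

lemma tournament_root_le:
  fixes n q :: nat and f :: "nat \<Rightarrow> real"
  assumes tree: "\<forall>q. 1 \<le> q \<and> q < n \<longrightarrow> V q = better f (V (2 * q)) (V (2 * q + 1))"
    and "1 \<le> q" "q < 2 * n" "V q \<noteq> 0"
  shows "V 1 \<noteq> 0 \<and> f (V 1 - 1) \<le> f (V q - 1)"
  using assms(2-)
proof (induction q rule: less_induct)
  case (less q)
  show ?case
  proof (cases "q = 1")
    case False
    define h where "h = q div 2"
    have h: "1 \<le> h" "h < n" "h < q" "q = 2 * h \<or> q = 2 * h + 1"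
      using less.prems False by (auto simp: h_def)
    then have "V q = V (2 * h) \<or> V q = V (2 * h + 1)" by blast
    then have "V h \<noteq> 0 \<and> f (V h - 1) \<le> f (V q - 1)"
      using less.prems(3) unfolding tree[rule_format, OF conjI[OF h(1,2)]] by (auto simp: better_def)
    moreover have "h < 2 * n" using h(2) by simp
    ultimately show ?thesis using less.IH[OF h(3,1)] by linarith
  qed (use less.prems in auto)
qed

text \<open>Descending to the child whose code was copied ends in a leaf. So the root is not just a
  lower bound but names an actual entry.\<close>

lemma tournament_leaf:
  fixes n q :: nat and f :: "nat \<Rightarrow> real"
  assumes tree: "\<forall>q. 1 \<le> q \<and> q < n \<longrightarrow> V q = better f (V (2 * q)) (V (2 * q + 1))"
    and "1 \<le> q" "q < 2 * n"
  shows "\<exists>l<n. V q = V (n + l)"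
  using assms(2-)
proof (induction "2 * n - q" arbitrary: q rule: less_induct)
  case less
  show ?case
  proof (cases "q < n")
    case True
    then have "V q = V (2 * q) \<or> V q = V (2 * q + 1)"
      unfolding tree[rule_format, OF conjI[OF less.prems(1) True]] by (simp add: better_def)
    then obtain c where c: "c = 2 * q \<or> c = 2 * q + 1" "V q = V c" by blast
    have "2 * n - c < 2 * n - q" "1 \<le> c" "c < 2 * n"
      using less.prems True c(1) by linarith+
    then show ?thesis using less.hyps c(2) by metis
  next
    case False
    then show ?thesis using less.prems by (intro exI[of _ "q - n"]) auto
  qed
qed

lemma tournament_root:
  fixes n :: nat and f :: "nat \<Rightarrow> real"
  assumes tree: "\<forall>q. 1 \<le> q \<and> q < n \<longrightarrow> V q = better f (V (2 * q)) (V (2 * q + 1))"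
    and leaf: "\<And>r. r < n \<Longrightarrow> V (n + r) = (if A r then Suc r else 0)"
    and "0 < n"
  shows "V 1 = 0 \<and> (\<forall>r<n. \<not> A r) \<or>
    (\<exists>r<n. V 1 = Suc r \<and> A r \<and> (\<forall>r'<n. A r' \<longrightarrow> f r \<le> f r'))"
proof -
  have *: "V 1 \<noteq> 0 \<and> f (V 1 - 1) \<le> f r" if "r < n" "A r" for r
  proof -
    have "V (n + r) = Suc r" using that leaf by simp
    then show ?thesis
      using tournament_root_le[OF tree, of "n + r"] that by simp
  qed
  obtain l where l: "l < n" "V 1 = V (n + l)"
    using tournament_leaf[OF tree, of 1] \<open>0 < n\<close> by auto
  show ?thesis
  proof (cases "A l")
    case True
    then have "V 1 = Suc l" using l leaf[OF l(1)] by simp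
    then show ?thesis using True l(1) * by (metis diff_Suc_1)
  next
    case False
    then have "V 1 = 0" using l leaf[OF l(1)] by simp
    then show ?thesis using * by blast
  qed
qed

section \<open>Tournament trees for all pairs of columns in one array\<close>

locale solver =
  fixes n K W :: nat and D :: "nat \<Rightarrow> real"
  assumes K2: "2 \<le> K" and Kn: "K \<le> n" and W: "W = n ^ 4"
begin

definition d :: "nat \<Rightarrow> nat \<Rightarrow> real" where
  "d r k = D (r * K + k)"

definition addr :: "nat \<Rightarrow> nat \<Rightarrow> nat \<Rightarrow> nat" where
  "addr j k q = (j * K + k) * (2 * n) + q"

definition inst :: "memory \<Rightarrow> bool" where
  "inst s \<longleftrightarrow> fst s ''n'' 0 = n \<and> fst s ''K'' 0 = K \<and> snd s ''D'' = D"

definition forest :: "(nat \<Rightarrow> nat \<Rightarrow> nat \<Rightarrow> bool) \<Rightarrow> nat \<times> nat \<times> nat \<Rightarrow> (nat \<Rightarrow> nat) \<Rightarrow> bool" where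
  "forest A e T \<longleftrightarrow> (\<forall>a. T a \<le> n) \<and>
    (\<forall>j<K. \<forall>k<K. \<forall>q. 1 \<le> q \<and> q < n \<and> (j, k, q) \<noteq> e \<longrightarrow>
       T (addr j k q) = better (\<lambda>r. d r k - d r j) (T (addr j k (2 * q))) (T (addr j k (2 * q + 1)))) \<and>
    (\<forall>j<K. \<forall>k<K. \<forall>r<n. T (addr j k (n + r)) = (if A j k r then Suc r else 0))"

lemma forestD:
  assumes "forest A e T"
  shows "T a \<le> n"
    and "j < K \<Longrightarrow> k < K \<Longrightarrow> 1 \<le> q \<Longrightarrow> q < n \<Longrightarrow> (j, k, q) \<noteq> e \<Longrightarrow>
      T (addr j k q) = better (\<lambda>r. d r k - d r j) (T (addr j k (2 * q))) (T (addr j k (2 * q + 1)))"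
    and "j < K \<Longrightarrow> k < K \<Longrightarrow> r < n \<Longrightarrow> T (addr j k (n + r)) = (if A j k r then Suc r else 0)"
  using assms unfolding forest_def by blast+

lemma n2: "2 \<le> n" using K2 Kn by simp

lemma addr_inj:
  assumes "k < K" "k' < K" "q < 2 * n" "q' < 2 * n"
  shows "addr j k q = addr j' k' q' \<longleftrightarrow> j = j' \<and> k = k' \<and> q = q'"
proof
  have dm: "(a * m + b) div m = a \<and> (a * m + b) mod m = b" if "b < m" for a b m :: nat
    using that by simp
  assume eq: "addr j k q = addr j' k' q'"
  have "j * K + k = j' * K + k'" "q = q'"
    using dm[OF assms(3), of "j * K + k"] dm[OF assms(4), of "j' * K + k'"] eq unfolding addr_def by metis+
  then show "j = j' \<and> k = k' \<and> q = q'"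
    using dm[OF assms(1), of j] dm[OF assms(2), of j'] by metis
qed auto

lemma forest_root:
  assumes "forest A (j', k', 0) T" "j < K" "k < K"
  shows "T (addr j k 1) = 0 \<and> (\<forall>r<n. \<not> A j k r) \<or>
    (\<exists>r<n. T (addr j k 1) = Suc r \<and> A j k r \<and> (\<forall>r'<n. A j k r' \<longrightarrow> d r k - d r j \<le> d r' k - d r' j))"
  by (rule tournament_root[where V = "\<lambda>q. T (addr j k q)"]) (use assms n2 in \<open>auto simp: forest_def\<close>)

lemma update_other:
  assumes "(j, k, q) \<noteq> (j', k', q')" "k < K" "k' < K" "q < 2 * n" "q' < 2 * n"
  shows "(T(addr j k q := v)) (addr j' k' q') = T (addr j' k' q')"
  using assms addr_inj[of k k' q q' j j'] by auto

text \<open>Node \<open>q\<close> is a child of \<open>q div 2\<close> only, so recomputing it moves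
  the defect one level up. Recomputing the root moves it to node 0, which means that no defect is
  left.\<close>

lemma forest_node:
  assumes f: "forest A (j, k, q) T" and "j < K" "k < K" "1 \<le> q" "q < n"
    and v: "v = better (\<lambda>r. d r k - d r j) (T (addr j k (2 * q))) (T (addr j k (2 * q + 1)))"
  shows "forest A (j, k, q div 2) (T(addr j k q := v))"
proof -
  note other = update_other[of j k q _ _ _ T v]
  have "v \<le> n" using f v by (auto simp: forest_def better_def)
  moreover have "(T(addr j k q := v)) (addr j' k' p) = better (\<lambda>r. d r k' - d r j')
        ((T(addr j k q := v)) (addr j' k' (2 * p))) ((T(addr j k q := v)) (addr j' k' (2 * p + 1)))"
    if p: "j' < K" "k' < K" "1 \<le> p" "p < n" "(j', k', p) \<noteq> (j, k, q div 2)" for j' k' p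
  proof -
    have "q div 2 = p" if "q = 2 * p \<or> q = 2 * p + 1"
      using that by fastforce
    then have "(j, k, q) \<noteq> (j', k', 2 * p)" "(j, k, q) \<noteq> (j', k', 2 * p + 1)"
      using p(5) unfolding prod.inject by metis+
    then have c: "(T(addr j k q := v)) (addr j' k' (2 * p)) = T (addr j' k' (2 * p))"
      "(T(addr j k q := v)) (addr j' k' (2 * p + 1)) = T (addr j' k' (2 * p + 1))"
      using other p assms(2-5) by auto
    show ?thesis
    proof (cases "(j, k, q) = (j', k', p)")
      case True
      then show ?thesis unfolding c using v by auto
    next
      case False
      then have "(T(addr j k q := v)) (addr j' k' p) = T (addr j' k' p)"
        using other p assms(2-5) by auto
      moreover have "T (addr j' k' p) = better (\<lambda>r. d r k' - d r j') (T (addr j' k' (2 * p))) (T (addr j' k' (2 * p + 1)))"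
        by (rule forestD(2)[OF f]) (use p False in auto)
      ultimately show ?thesis unfolding c by simp
    qed
  qed
  moreover have "(T(addr j k q := v)) (addr j' k' (n + r)) = (if A j' k' r then Suc r else 0)"
    if "j' < K" "k' < K" "r < n" for j' k' r
    using f that other[of j' k' "n + r"] assms(2-5) by (auto simp: forest_def)
  moreover have "(T(a := v)) b \<le> n" for a b
    using forestD(1)[OF f, of b] \<open>v \<le> n\<close> by simp
  ultimately show ?thesis
    unfolding forest_def by blast
qed

lemma forest_leaf:
  assumes f: "forest A (j', k', 0) T" and "j < K" "k < K" "r < n" and v: "v = (if B then Suc r else 0)"
  shows "forest (\<lambda>a b c. if a = j \<and> b = k \<and> c = r then B else A a b c) (j, k, (n + r) div 2)
    (T(addr j k (n + r) := v))"
proof -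
  let ?T = "T(addr j k (n + r) := v)"
  note other = update_other[of j k "n + r" _ _ _ T v]
  have "v \<le> n" using assms by auto
  moreover have "?T (addr a b p) = better (\<lambda>r. d r b - d r a) (?T (addr a b (2 * p))) (?T (addr a b (2 * p + 1)))"
    if p: "a < K" "b < K" "1 \<le> p" "p < n" "(a, b, p) \<noteq> (j, k, (n + r) div 2)" for a b p
  proof -
    have "(n + r) div 2 = p" if "n + r = 2 * p \<or> n + r = 2 * p + 1"
      using that by (elim disjE) simp_all
    then have "(j, k, n + r) \<noteq> (a, b, 2 * p)" "(j, k, n + r) \<noteq> (a, b, 2 * p + 1)"
      using p(5) unfolding prod.inject by metis+
    then have "?T (addr a b (2 * p)) = T (addr a b (2 * p))"
      "?T (addr a b (2 * p + 1)) = T (addr a b (2 * p + 1))"  "?T (addr a b p) = T (addr a b p)"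
      using other p assms(2-4) by auto
    moreover have "T (addr a b p) = better (\<lambda>r. d r b - d r a) (T (addr a b (2 * p))) (T (addr a b (2 * p + 1)))"
      by (rule forestD(2)[OF f]) (use p in auto)
    ultimately show ?thesis by simp
  qed
  moreover have "?T (addr a b (n + c)) = (if if a = j \<and> b = k \<and> c = r then B else A a b c then Suc c else 0)"
    if "a < K" "b < K" "c < n" for a b c
  proof (cases "(a, b, c) = (j, k, r)")
    case True
    then show ?thesis by (simp add: v)
  next
    case False
    then have "?T (addr a b (n + c)) = T (addr a b (n + c))"
      using that assms(2-4) by (intro other) auto
    with False show ?thesis using forestD(3)[OF f that] by auto
  qed
  moreover have "(T(a := v)) b \<le> n" for a b
    using forestD(1)[OF f, of b] \<open>v \<le> n\<close> by simp
  ultimately show ?thesis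
    unfolding forest_def by blast
qed

lemma forest_cong:
  assumes "forest A (j', k', 0) T" "\<And>j k r. j < K \<Longrightarrow> k < K \<Longrightarrow> r < n \<Longrightarrow> A j k r = B j k r"
  shows "forest B (j, k, 0) T"
  using assms by (auto simp: forest_def)

text \<open>The exponent 4 of the word bound originates here: there are K^2 trees of 2 n cells each,
  and both factors are at most n^2.\<close>

lemma addr_le: "j < K \<Longrightarrow> k < K \<Longrightarrow> q < 2 * n \<Longrightarrow> addr j k q \<le> W"
proof -
  assume *: "j < K" "k < K" "q < 2 * n"
  then have "Suc (j * K + k) \<le> Suc j * K" by simp
  also have "\<dots> \<le> n * n" using * Kn by (intro mult_mono) auto
  finally have "Suc (j * K + k) * (2 * n) \<le> n * n * (n * n)"
    using n2 by (intro mult_mono) auto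
  moreover have "addr j k q \<le> Suc (j * K + k) * (2 * n)"
    using *(3) by (simp add: addr_def)
  ultimately show ?thesis by (simp add: W power4_eq_xxxx)
qed

lemma W_ge: "n * n \<le> W" "2 * n \<le> W"
proof -
  have "1 \<le> n * n" and le: "2 * n \<le> n * n" using n2 by auto
  then have "n * n * 1 \<le> n * n * (n * n)" by (intro mult_le_mono) simp_all
  moreover have "W = n * n * (n * n)" by (simp add: W power4_eq_xxxx)
  ultimately show "n * n \<le> W" "2 * n \<le> W" using le by linarith+
qed

end

text \<open>
  Row \<open>r\<close> is represented by \<open>r + 1\<close> in the trees, 0 standing for "no row". The tree of the pair
  \<open>(j, k)\<close> occupies the cells \<open>addr j k q\<close> of \<open>T\<close> with \<open>1 \<le> q < 2 n\<close>: the root is \<open>q = 1\<close>, the children of \<open>q\<close>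
  are \<open>2 q\<close> and \<open>2 q + 1\<close>, and the leaf of row \<open>r\<close> is \<open>q = n + r\<close>. Since 0 represents an empty
  tree, no initialization is needed. The exception \<open>e\<close> in \<open>forest\<close> is the only node that may
  currently disagree with its children; \<open>q = 0\<close> means that there is none.
\<close>

definition upd_step :: com where
  "upd_step =
    Seq (st ''p'' (NDiv (sc ''p'') (NConst 2)))
    (Seq (st ''x'' (NRead ''T'' (NAdd (sc ''b'') (NMul (NConst 2) (sc ''p'')))))
    (Seq (st ''z'' (NRead ''T'' (NAdd (sc ''b'') (NAdd (NMul (NConst 2) (sc ''p'')) (NConst 1)))))
    (Cond (BAnd (NLess (NConst 0) (sc ''z'')) (BNot (BAnd (NLess (NConst 0) (sc ''x''))
        (BNot (RLess
          (RSub (RRead ''D'' (NAdd (NMul (NSub (sc ''z'') (NConst 1)) (sc ''K'')) (sc ''c'')))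
                (RRead ''D'' (NAdd (NMul (NSub (sc ''z'') (NConst 1)) (sc ''K'')) (sc ''j''))))
          (RSub (RRead ''D'' (NAdd (NMul (NSub (sc ''x'') (NConst 1)) (sc ''K'')) (sc ''c'')))
                (RRead ''D'' (NAdd (NMul (NSub (sc ''x'') (NConst 1)) (sc ''K'')) (sc ''j'')))))))))
      (NStore ''T'' (NAdd (sc ''b'') (sc ''p'')) (sc ''z''))
      (NStore ''T'' (NAdd (sc ''b'') (sc ''p'')) (sc ''x'')))))"

text \<open>Arguments are passed in scalars: \<open>j\<close> and \<open>c\<close> select the tree,
  \<open>r\<close> the row, and \<open>v\<close> is the new code of its leaf, \<open>r + 1\<close>
  to enter the row and 0 to remove it. The loop repairs the ancestors of the leaf.\<close>

definition upd :: com where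
  "upd =
    Seq (st ''b'' (NMul (NAdd (NMul (sc ''j'') (sc ''K'')) (sc ''c'')) (NMul (NConst 2) (sc ''n''))))
    (Seq (st ''p'' (NAdd (sc ''n'') (sc ''r'')))
    (Seq (NStore ''T'' (NAdd (sc ''b'') (sc ''p'')) (sc ''v''))
    (While (NLess (NConst 1) (sc ''p'')) upd_step)))"

lemma writes_upd [simp]: "nwrites upd = {''b'', ''p'', ''T'', ''x'', ''z''}" "rwrites upd = {}"
  by (auto simp: upd_def upd_step_def)

section \<open>Correctness of a single leaf update\<close>

context solver
begin

text \<open>Node \<open>p\<close> has just been written, so its parent is the possible defect. At
  most \<open>l\<close> halvings remain until the root; initially \<open>p = n + r < 2 * n\<close>,
  so any \<open>l\<close> with \<open>n < 2 ^ l\<close> is large enough.\<close>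

definition upd_inv where
  "upd_inv A j c l s \<longleftrightarrow> inst s \<and> fst s ''j'' 0 = j \<and> fst s ''c'' 0 = c \<and> fst s ''b'' 0 = addr j c 0 \<and>
     1 \<le> fst s ''p'' 0 \<and> fst s ''p'' 0 < 2 * n \<and> fst s ''p'' 0 < 2 ^ Suc l \<and>
     forest A (j, c, fst s ''p'' 0 div 2) (fst s ''T'')"

lemma runs_upd_step:
  assumes "upd_inv A j c l s" "1 < fst s ''p'' 0" "j < K" "c < K"
  shows "0 < l" "runs W upd_step s 100 (upd_inv A j c (l - 1))"
proof -
  let ?T = "fst s ''T''"
  define p where "p = fst s ''p'' 0 div 2"
  have p: "1 \<le> p" "p < n" "p < 2 * n" using assms by (auto simp: upd_inv_def p_def)
  show l: "0 < l" using assms by (cases l) (auto simp: upd_inv_def)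
  then have l: "p < 2 ^ Suc (l - 1)"
    using assms by (auto simp: upd_inv_def p_def)
  have f: "forest A (j, c, p) ?T" "inst s" using assms by (auto simp: upd_inv_def p_def)
  have eqs: "fst s ''j'' 0 = j" "fst s ''c'' 0 = c" "fst s ''b'' 0 = addr j c 0"
    "fst s ''n'' 0 = n" "fst s ''K'' 0 = K" "snd s ''D'' = D" "fst s ''p'' 0 div 2 = p"
    using assms f by (auto simp: upd_inv_def inst_def p_def)
  have a: "addr j c 0 + q = addr j c q" for q by (simp add: addr_def)
  define x z where "x = ?T (addr j c (2 * p))" and "z = ?T (addr j c (2 * p + 1))"
  have xz: "?T (addr j c (2 * p)) = x" "?T (Suc (addr j c (2 * p))) = z"
    by (simp_all add: x_def z_def addr_def)
  have *: "forest A (j, c, p div 2) (?T(addr j c p := better (\<lambda>r. d r c - d r j) x z))"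
    by (rule forest_node[OF f(1)]) (use assms p in \<open>auto simp: x_def z_def\<close>)
  have T: "?T a \<le> n" for a using f by (auto simp: forest_def)
  have le: "x \<le> W" "z \<le> W" "p \<le> W" using T[of "addr j c (2 * p)"] T[of "addr j c (2 * p + 1)"] W_ge p
    by (auto simp: x_def z_def)
  show "runs W upd_step s 100 (upd_inv A j c (l - 1))"
    unfolding upd_step_def
    using p l *
    by (intro runs_intros)
      (simp_all add: eqs a d_def le xz upd_inv_def inst_def better_def del: power_Suc split: if_splits)
qed

lemma runs_upd:
  assumes "inst s" "forest A (j', k', 0) (fst s ''T'')" "n < 2 ^ l"
    and "j < K" "c < K" "r < n" and v: "v = (if B then Suc r else 0)"
    and eqs: "fst s ''j'' 0 = j" "fst s ''c'' 0 = c" "fst s ''r'' 0 = r" "fst s ''v'' 0 = v"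
    and A': "\<And>a b e. a < K \<Longrightarrow> b < K \<Longrightarrow> e < n \<Longrightarrow> A' a b e = (if a = j \<and> b = c \<and> e = r then B else A a b e)"
  shows "runs W upd s (200 * Suc l) (\<lambda>s'. forest A' (0, 0, 0) (fst s' ''T''))"
proof -
  define A1 where "A1 = (\<lambda>a b e. if a = j \<and> b = c \<and> e = r then B else A a b e)"
  let ?s = "nstore ''T'' (addr j c (n + r)) v (nstore ''p'' 0 (n + r) (nstore ''b'' 0 (addr j c 0) s))"
  let ?w = "While (NLess (NConst 1) (sc ''p'')) upd_step"
  have eqs': "fst s ''n'' 0 = n" "fst s ''K'' 0 = K" using assms(1) by (auto simp: inst_def)
  have "forest A1 (j, c, (n + r) div 2) ((fst s ''T'')(addr j c (n + r) := v))"
    unfolding A1_def by (rule forest_leaf[OF assms(2,4-7)])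
  then have "upd_inv A1 j c l ?s"
    using assms(1,3,6) n2 by (simp add: upd_inv_def inst_def eqs)
  from runs_While[where I = "upd_inv A1 j c", OF this, where b = "NLess (NConst 1) (sc ''p'')" and T = 100 and c = upd_step and W = W]
  have w: "runs W ?w ?s (l * (1 + btime (NLess (NConst 1) (sc ''p'')) + 100) + 1 + btime (NLess (NConst 1) (sc ''p'')))
    (\<lambda>s'. \<not> bval s' (NLess (NConst 1) (sc ''p'')) \<and> (\<exists>l. upd_inv A1 j c l s'))"
    using runs_upd_step[of A1 j c, OF _ _ assms(4,5)] by simp
  \<comment> \<open>The budget is left arbitrary because symbolic execution presents what remains of
    it as a difference. A round costs 5 for the test and 100 for \<open>upd_step\<close>.\<close>
  have w: "runs W ?w ?s T (\<lambda>s'. forest A' (0, 0, 0) (fst s' ''T''))" if "l * 105 + 5 \<le> T" for T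
  proof (rule runs_conseq[OF w])
    fix s' assume "\<not> bval s' (NLess (NConst 1) (sc ''p'')) \<and> (\<exists>l. upd_inv A1 j c l s')"
    then obtain l where *: "upd_inv A1 j c l s'" "fst s' ''p'' 0 \<le> 1" by auto
    then have "fst s' ''p'' 0 div 2 = 0" by simp
    with * have "forest A1 (j, c, 0) (fst s' ''T'')" unfolding upd_inv_def by simp
    then show "forest A' (0, 0, 0) (fst s' ''T'')"
      by (rule forest_cong) (simp add: A' A1_def)
  qed (use that in simp)
  have "addr j c (n + r) \<le> W" by (rule addr_le) (use assms in auto)
  then have "addr j c 0 \<le> W" "n + r \<le> W" "v \<le> W"
    using assms(4-7) W_ge by (auto simp: addr_def)
  moreover have a: "addr j c 0 + q = addr j c q" "(j * K + c) * (2 * n) = addr j c 0" for q by (simp_all add: addr_def)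
  ultimately show ?thesis
    unfolding upd_def by (intro runs_intros) (simp_all add: eqs eqs' a w[simplified])
qed

end

section \<open>Augmenting along a path\<close>

text \<open>
  \<open>asg\<close> maps a row to its column plus 1, or to 0 if the row is not yet inserted; \<open>via\<close> maps a column
  to the row that has to move into it on a shortest path, and \<open>dn\<close> to the round in which
  Dijkstra's algorithm finished it (0 if unfinished). \<open>h\<close> is 1 plus the column that currently
  receives a row, and 0 at the end of the path.
\<close>

definition setcol :: com where
  "setcol = For ''c'' ''K'' upd"

text \<open>Taking row \<open>r\<close> out of its old column opens the gap that the next round
  fills, so \<open>q\<close> becomes the new \<open>h\<close>. The row being inserted has old code
  \<open>q = 0\<close>, and this ends the loop.\<close>

definition aug_step :: com where
  "aug_step =
    Seq (st ''r'' (NRead ''via'' (NSub (sc ''h'') (NConst 1))))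
    (Seq (st ''q'' (NRead ''asg'' (sc ''r'')))
    (Seq (Cond (NLess (NConst 0) (sc ''q''))
      (Seq (st ''j'' (NSub (sc ''q'') (NConst 1))) (Seq (st ''v'' (NConst 0)) setcol)) Skip)
    (Seq (NStore ''asg'' (sc ''r'') (sc ''h''))
    (Seq (st ''j'' (NSub (sc ''h'') (NConst 1)))
    (Seq (st ''v'' (NAdd (sc ''r'') (NConst 1)))
    (Seq setcol (st ''h'' (sc ''q''))))))))"

definition aug :: com where
  "aug = While (NLess (NConst 0) (sc ''h'')) aug_step"

lemma writes_setcol [simp]: "nwrites setcol = {''c'', ''b'', ''p'', ''T'', ''x'', ''z''}" "rwrites setcol = {}"
  by (auto simp: setcol_def)

lemma writes_aug [simp]:
  "nwrites aug = {''r'', ''q'', ''j'', ''v'', ''asg'', ''h'', ''c'', ''b'', ''p'', ''T'', ''x'', ''z''}" "rwrites aug = {}"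
  by (auto simp: aug_def aug_step_def)

lemma card_update:
  fixes a :: "nat \<Rightarrow> nat"
  assumes "r < n"
  shows "card {x. x < n \<and> (a(r := u)) x = w} + (if a r = w then 1 else 0) =
    card {x. x < n \<and> a x = w} + (if u = w then 1 else 0)"
proof -
  let ?S = "{x. x < n \<and> x \<noteq> r \<and> a x = w}"
  have "{x. x < n \<and> (a(r := u)) x = w} = (if u = w then insert r ?S else ?S)"
    "{x. x < n \<and> a x = w} = (if a r = w then insert r ?S else ?S)"
    using assms by auto
  then show ?thesis by simp
qed

section \<open>Correctness of the moves along a path\<close>

context solver
begin

abbreviation setcol_time where
  "setcol_time l \<equiv> K * (200 * Suc l + 12) + 10"

lemma runs_setcol:
  assumes "inst s" "forest A (j', k', 0) (fst s ''T'')" "n < 2 ^ l"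
    and "j < K" "r < n" "v = (if B then Suc r else 0)"
    and eqs: "fst s ''j'' 0 = j" "fst s ''r'' 0 = r" "fst s ''v'' 0 = v"
    and A': "\<And>a b e. a < K \<Longrightarrow> b < K \<Longrightarrow> e < n \<Longrightarrow> A' a b e = (if a = j \<and> e = r then B else A a b e)"
  shows "runs W setcol s (setcol_time l) (\<lambda>s'. forest A' (0, 0, 0) (fst s' ''T''))"
proof -
  \<comment> \<open>In the middle of the loop the leaf of \<open>r\<close> has been changed in the
    trees \<open>(j, b)\<close> with \<open>b < k\<close> only. This is why the membership predicate
    of \<open>forest\<close> takes the target column as an argument.\<close>
  define Ak where "Ak k = (\<lambda>a b e. if a = j \<and> e = r \<and> b < k then B else A a b e)" for k
  define I where "I k s' \<longleftrightarrow> inst s' \<and> forest (Ak k) (0, 0, 0) (fst s' ''T'') \<and>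
    fst s' ''j'' 0 = j \<and> fst s' ''r'' 0 = r \<and> fst s' ''v'' 0 = v" for k s'
  have "runs W (For ''c'' ''K'' upd) s (setcol_time l) (I K)"
  proof (rule runs_For[where T = "200 * Suc l" and N = K])
    show "I 0 (nstore ''c'' 0 0 s)"
      using assms(1) forest_cong[OF assms(2), of "Ak 0" 0 0] eqs by (simp add: I_def inst_def Ak_def)
    show "fst s ''K'' 0 = K" using assms(1) by (simp add: inst_def)
    show "K \<le> W" using Kn W_ge n2 by linarith
    fix k s1 assume k: "k < K" and I: "I k s1" and c: "fst s1 ''c'' 0 = k"
    have "runs W upd s1 (200 * Suc l) (\<lambda>s'. forest (Ak (Suc k)) (0, 0, 0) (fst s' ''T''))"
      by (rule runs_upd[of _ "Ak k" 0 0 l j k r v B]) (use I c k assms in \<open>auto simp: I_def Ak_def\<close>)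
    then show "runs W upd s1 (200 * Suc l) (\<lambda>s'. I (Suc k) (nstore ''c'' 0 (Suc k) s'))"
      by (rule runs_conseq) (use I in \<open>simp_all add: I_def inst_def frame_def\<close>)
  qed (auto simp: algebra_simps)
  then show ?thesis
    unfolding setcol_def
  proof (rule runs_conseq)
    fix s' assume "I K s'"
    then have "forest (Ak K) (0, 0, 0) (fst s' ''T'')" by (simp add: I_def)
    then show "forest A' (0, 0, 0) (fst s' ''T'')"
      by (rule forest_cong) (simp add: A' Ak_def)
  qed simp
qed

text \<open>The moves start at the end \<open>t\<close> of the path and work back to the new row
  \<open>i\<close>. The clause about \<open>via\<close> says that the rest of the path is intact; it
  ranges over all columns of rank at most that of the current one, so that no path has to be named.
  In the counting clause the column waiting for a row counts as having it already; at the end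
  (\<open>h = 0\<close>) exactly column \<open>t\<close> has gained a row.\<close>

definition path_inv :: "nat \<Rightarrow> nat \<Rightarrow> (nat \<Rightarrow> nat) \<Rightarrow> (nat \<Rightarrow> nat) \<Rightarrow> (nat \<Rightarrow> nat) \<Rightarrow> nat \<Rightarrow> nat \<Rightarrow> (nat \<Rightarrow> nat) \<Rightarrow> bool" where
  "path_inv i t a0 via dn l h a \<longleftrightarrow> h \<le> K \<and> (0 < h \<longrightarrow> dn (h - 1) \<le> l) \<and>
     (0 < h \<longrightarrow> (\<forall>k<K. dn k \<le> dn (h - 1) \<longrightarrow> a (via k) = 0 \<or> (\<exists>j<K. a (via k) = Suc j \<and> dn j < dn k))) \<and>
     (\<forall>r<n. a r = a0 r \<or> (\<exists>k<K. via k = r \<and> a r = Suc k)) \<and>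
     (\<forall>r<n. a r \<noteq> 0 \<longleftrightarrow> a0 r \<noteq> 0 \<or> h = 0 \<and> r = i) \<and>
     (\<forall>c<K. card {x. x < n \<and> a x = Suc c} + (if h = Suc c then 1 else 0) =
        card {x. x < n \<and> a0 x = Suc c} + (if c = t then 1 else 0))"

text \<open>
  The rows already moved came from columns finished no earlier than the current one,
  so that the remaining path is not affected by the moves; the rank \<open>dn\<close> decreases along it.
\<close>

lemma path_inv_step:
  assumes inv: "path_inv i t a0 via dn l (Suc k) a"
    and "i < n" "a0 i = 0" and via: "\<And>k. k < K \<Longrightarrow> via k < n \<and> 0 < dn k \<and> (a0 (via k) = 0 \<longrightarrow> via k = i)"
  shows "0 < l" "path_inv i t a0 via dn (l - 1) (a (via k)) (a(via k := Suc k))"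
proof -
  let ?q = "a (via k)" and ?a = "a(via k := Suc k)"
  have k: "k < K" "dn k \<le> l" using inv by (auto simp: path_inv_def)
  note v = via[OF k(1)]
  show "0 < l" using v k by auto
  have q: "?q = 0 \<or> (\<exists>j<K. ?q = Suc j \<and> dn j < dn k)"
    using inv k by (auto simp: path_inv_def)
  have "?q = 0 \<longleftrightarrow> a0 (via k) = 0" using inv v by (auto simp: path_inv_def)
  then have q0: "?q = 0 \<longleftrightarrow> via k = i" using v assms(3) by auto
  have 1: "?a (via k') = 0 \<or> (\<exists>j<K. ?a (via k') = Suc j \<and> dn j < dn k')"
    if k': "k' < K" "dn k' \<le> dn (?q - 1)" "0 < ?q" for k'
  proof -
    obtain j where j: "j < K" "?q = Suc j" "dn j < dn k" using q k'(3) by auto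
    have *: "a (via k') = 0 \<or> (\<exists>j<K. a (via k') = Suc j \<and> dn j < dn k')"
      using inv k' j by (auto simp: path_inv_def)
    have "via k' \<noteq> via k"
    proof
      assume "via k' = via k"
      then have "dn j < dn k'" using * j by auto
      then show False using k' j by simp
    qed
    with * show ?thesis by simp
  qed
  have 2: "?a r = a0 r \<or> (\<exists>k<K. via k = r \<and> ?a r = Suc k)" if "r < n" for r
    using inv that k by (auto simp: path_inv_def)
  have 3: "?a r \<noteq> 0 \<longleftrightarrow> a0 r \<noteq> 0 \<or> ?q = 0 \<and> r = i" if "r < n" for r
  proof (cases "r = via k")
    case True
    then show ?thesis using v q0 by auto
  next
    case False
    then show ?thesis using inv that q0 by (auto simp: path_inv_def)
  qed
  have 4: "card {x. x < n \<and> ?a x = Suc c} + (if ?q = Suc c then 1 else 0) =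
        card {x. x < n \<and> a0 x = Suc c} + (if c = t then 1 else 0)" if "c < K" for c
    using card_update[of "via k" n a "Suc k" "Suc c"] inv that v by (auto simp: path_inv_def)
  have 5: "?q \<le> K" "0 < ?q \<longrightarrow> dn (?q - 1) \<le> l - 1" using q k by auto
  show "path_inv i t a0 via dn (l - 1) ?q ?a"
    unfolding path_inv_def using 1 2 3 4 5 by blast
qed

definition aug_inv where
  "aug_inv i t a0 via dn m s \<longleftrightarrow> inst s \<and> fst s ''via'' = via \<and>
    forest (\<lambda>j c x. fst s ''asg'' x = Suc j) (0, 0, 0) (fst s ''T'') \<and>
    path_inv i t a0 via dn m (fst s ''h'' 0) (fst s ''asg'')"

lemma runs_aug_step:
  assumes inv: "aug_inv i t a0 via dn m s" and h0: "0 < fst s ''h'' 0"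
    and i: "i < n" "a0 i = 0" and l: "n < 2 ^ l"
    and via: "\<And>k. k < K \<Longrightarrow> via k < n \<and> 0 < dn k \<and> (a0 (via k) = 0 \<longrightarrow> via k = i)"
  shows "0 < m \<and> runs W aug_step s (2 * setcol_time l + 100) (aug_inv i t a0 via dn (m - 1))"
proof -
  define a where "a = fst s ''asg''"
  obtain k where h: "fst s ''h'' 0 = Suc k" using h0 gr0_conv_Suc by auto
  define r q where "r = via k" and "q = a r"
  have inst: "inst s" and f: "forest (\<lambda>j c x. a x = Suc j) (0, 0, 0) (fst s ''T'')"
    and p: "path_inv i t a0 via dn m (Suc k) a" and eqs: "fst s ''via'' = via"
    using inv h by (simp_all add: aug_inv_def a_def)
  define a' where "a' = a(r := Suc k)"
  have p': "0 < m" "path_inv i t a0 via dn (m - 1) q a'"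
    using path_inv_step[OF p i via] by (simp_all add: r_def q_def a'_def)
  have k: "k < K" "r < n" using p via unfolding path_inv_def r_def by auto
  have q: "q \<le> K" using p'(2) by (simp add: path_inv_def)
  have W': "r \<le> W" "Suc r \<le> W" "q \<le> W" "k \<le> W" "Suc k \<le> W" "q - Suc 0 \<le> W" "q - 1 \<le> W" using k q Kn W_ge n2 by linarith+
  let ?s = "nstore ''q'' 0 q (nstore ''r'' 0 r s)"
  \<comment> \<open>Between the two calls of \<open>setcol\<close> row \<open>r\<close> is in no
    tree, although \<open>asg\<close> may still record its old column.\<close>
  let ?A = "\<lambda>j c x. x \<noteq> r \<and> a x = Suc j"
  let ?c1 = "Cond (NLess (NConst 0) (sc ''q''))
      (Seq (st ''j'' (NSub (sc ''q'') (NConst 1))) (Seq (st ''v'' (NConst 0)) setcol)) Skip"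
  let ?c2 = "Seq (NStore ''asg'' (sc ''r'') (sc ''h''))
    (Seq (st ''j'' (NSub (sc ''h'') (NConst 1)))
    (Seq (st ''v'' (NAdd (sc ''r'') (NConst 1)))
    (Seq setcol (st ''h'' (sc ''q'')))))"
  have 1: "runs W ?c1 ?s (setcol_time l + 20) (\<lambda>s'. forest ?A (0, 0, 0) (fst s' ''T''))"
  proof (cases "q = 0")
    case True
    have "forest ?A (0, 0, 0) (fst s ''T'')"
      by (rule forest_cong[OF f]) (use True q_def in auto)
    then show ?thesis by (intro runs_intros) (simp_all add: True)
  next
    case False
    let ?s1 = "nstore ''v'' 0 0 (nstore ''j'' 0 (q - 1) ?s)"
    have "runs W setcol ?s1 (setcol_time l) (\<lambda>s'. forest ?A (0, 0, 0) (fst s' ''T''))"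
      by (rule runs_setcol[of _ "\<lambda>j c x. a x = Suc j" 0 0 l "q - 1" r 0 False])
        (use inst f l k q False in \<open>auto simp: inst_def q_def\<close>)
    then have "runs W setcol ?s1 T (\<lambda>s'. forest ?A (0, 0, 0) (fst s' ''T''))" if "setcol_time l \<le> T" for T
      by (rule runs_conseq) (use that in auto)
    from this[simplified] show ?thesis
      using False by (intro runs_intros) (simp_all add: W')
  qed
  have 2: "runs W ?c2 s1 (setcol_time l + 40) (aug_inv i t a0 via dn (m - 1))"
    if s1: "forest ?A (0, 0, 0) (fst s1 ''T'')" "frame ?c1 ?s s1" for s1
  proof -
    have e: "fst s1 ''h'' 0 = Suc k" "fst s1 ''r'' 0 = r" "fst s1 ''q'' 0 = q" "fst s1 ''asg'' = a"
      "fst s1 ''via'' = via" "fst s1 ''n'' 0 = n" "fst s1 ''K'' 0 = K" "snd s1 ''D'' = D"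
      using s1(2) h inst by (simp_all add: frame_def eqs a_def inst_def)
    let ?s2 = "nstore ''v'' 0 (Suc r) (nstore ''j'' 0 k (nstore ''asg'' r (Suc k) s1))"
    have "runs W setcol ?s2 (setcol_time l) (\<lambda>s'. forest (\<lambda>j c x. a' x = Suc j) (0, 0, 0) (fst s' ''T''))"
      by (rule runs_setcol[of _ ?A 0 0 l k r "Suc r" True])
        (use s1(1) l k in \<open>auto simp: inst_def e a'_def\<close>)
    then have "runs W (Seq setcol (st ''h'' (sc ''q''))) ?s2 (setcol_time l + 10) (aug_inv i t a0 via dn (m - 1))"
    proof (rule runs_Seq[where U = 10])
      fix s3 assume s3: "forest (\<lambda>j c x. a' x = Suc j) (0, 0, 0) (fst s3 ''T'')" "frame setcol ?s2 s3"
      then have e3: "fst s3 ''q'' 0 = q" "fst s3 ''asg'' = a'"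
        "fst s3 ''via'' = via" "fst s3 ''n'' 0 = n" "fst s3 ''K'' 0 = K" "snd s3 ''D'' = D"
        by (simp_all add: frame_def e a'_def)
      show "runs W (st ''h'' (sc ''q'')) s3 10 (aug_inv i t a0 via dn (m - 1))"
        using s3(1) p'(2) by (intro runs_intros) (simp_all add: e3 aug_inv_def inst_def W')
    qed simp
    then have "runs W (Seq setcol (st ''h'' (sc ''q''))) ?s2 T (aug_inv i t a0 via dn (m - 1))"
      if "setcol_time l + 10 \<le> T" for T
      by (rule runs_conseq) (use that in auto)
    from this[simplified] show ?thesis
      by (intro runs_intros) (simp_all add: e W')
  qed
  have "runs W (Seq ?c1 ?c2) ?s (2 * setcol_time l + 60) (aug_inv i t a0 via dn (m - 1))"
    by (rule runs_Seq[OF 1 2]) simp_all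
  then have "runs W (Seq ?c1 ?c2) ?s T (aug_inv i t a0 via dn (m - 1))" if "2 * setcol_time l + 60 \<le> T" for T
    by (rule runs_conseq) (use that in auto)
  from this[simplified] have "runs W aug_step s (2 * setcol_time l + 100) (aug_inv i t a0 via dn (m - 1))"
    unfolding aug_step_def
    by (intro runs_NStore_Seq) (simp_all add: h eqs W' flip: a_def r_def q_def)
  with p'(1) show ?thesis by simp
qed

text \<open>Ranks lie between 1 and \<open>K\<close> and fall strictly along the remaining path, so
  \<open>K\<close> rounds suffice.\<close>

lemma runs_aug:
  assumes "aug_inv i t a0 via dn K s" and i: "i < n" "a0 i = 0" and l: "n < 2 ^ l"
    and via: "\<And>k. k < K \<Longrightarrow> via k < n \<and> 0 < dn k \<and> (a0 (via k) = 0 \<longrightarrow> via k = i)"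
  shows "runs W aug s (K * (2 * setcol_time l + 110) + 10)
    (\<lambda>s'. forest (\<lambda>j c x. fst s' ''asg'' x = Suc j) (0, 0, 0) (fst s' ''T'') \<and>
       (\<exists>m. path_inv i t a0 via dn m 0 (fst s' ''asg'')))"
proof -
  have "runs W aug s (K * (1 + btime (NLess (NConst 0) (sc ''h'')) + (2 * setcol_time l + 100)) + 1 + btime (NLess (NConst 0) (sc ''h'')))
    (\<lambda>s'. \<not> bval s' (NLess (NConst 0) (sc ''h'')) \<and> (\<exists>m. aug_inv i t a0 via dn m s'))"
    unfolding aug_def
    by (rule runs_While[where I = "aug_inv i t a0 via dn"]) (use assms runs_aug_step in auto)
  then show ?thesis
    by (rule runs_conseq) (simp add: algebra_simps, auto simp: aug_inv_def)
qed

end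

section \<open>Dijkstra's algorithm\<close>

text \<open>\<open>L\<close> holds unreduced path lengths, so the next column is chosen by the
  reduced distance \<open>L k - y k\<close>. The scalar \<open>f\<close> is 1 plus the best
  unfinished column so far, and 0 if there is none.\<close>

definition sel_step :: com where
  "sel_step = Cond (BAnd (NLess (NRead ''dn'' (sc ''k'')) (NConst 1))
      (BNot (BAnd (NLess (NConst 0) (sc ''f'')) (BNot
        (RLess (RSub (RRead ''L'' (sc ''k'')) (RRead ''y'' (sc ''k'')))
          (RSub (RRead ''L'' (NSub (sc ''f'') (NConst 1))) (RRead ''y'' (NSub (sc ''f'') (NConst 1)))))))))
      (st ''f'' (NAdd (sc ''k'') (NConst 1))) Skip"

definition sel :: com where
  "sel = Seq (st ''f'' (NConst 0)) (For ''k'' ''K'' sel_step)"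

definition cand :: rexp where
  "cand = RAdd (RRead ''L'' (sc ''j''))
    (RSub (RRead ''D'' (NAdd (NMul (NSub (sc ''x'') (NConst 1)) (sc ''K'')) (sc ''k'')))
      (RRead ''D'' (NAdd (NMul (NSub (sc ''x'') (NConst 1)) (sc ''K'')) (sc ''j''))))"

definition relax_step :: com where
  "relax_step = Cond (NLess (NRead ''dn'' (sc ''k'')) (NConst 1))
    (Seq (st ''x'' (NRead ''T'' (NAdd (NMul (NAdd (NMul (sc ''j'') (sc ''K'')) (sc ''k'')) (NMul (NConst 2) (sc ''n''))) (NConst 1))))
      (Cond (BAnd (NLess (NConst 0) (sc ''x'')) (RLess cand (RRead ''L'' (sc ''k''))))
        (Seq (RStore ''L'' (sc ''k'') cand) (NStore ''via'' (sc ''k'') (NSub (sc ''x'') (NConst 1)))) Skip)) Skip"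

text \<open>The round is stored in \<open>dn\<close> before the relaxations: column \<open>j\<close>
  then counts as finished, and \<open>L j\<close>, on which every candidate depends, stays
  fixed.\<close>

definition dijkstra_step :: com where
  "dijkstra_step = Seq sel
    (Seq (st ''j'' (NSub (sc ''f'') (NConst 1)))
    (Seq (NStore ''dn'' (sc ''j'') (NAdd (sc ''s'') (NConst 1)))
    (For ''k'' ''K'' relax_step)))"

definition dijkstra :: com where
  "dijkstra = For ''s'' ''K'' dijkstra_step"

lemma writes_sel [simp]: "nwrites sel = {''f'', ''k''}" "rwrites sel = {}"
  by (auto simp: sel_def sel_step_def)

lemma writes_relax_step [simp]: "nwrites relax_step = {''x'', ''via''}" "rwrites relax_step = {''L''}"
  by (auto simp: relax_step_def)

lemma writes_dijkstra_step [simp]: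
  "nwrites dijkstra_step = {''f'', ''k'', ''j'', ''dn'', ''x'', ''via''}" "rwrites dijkstra_step = {''L''}"
  by (auto simp: dijkstra_step_def)

lemma writes_dijkstra [simp]:
  "nwrites dijkstra = {''s'', ''f'', ''k'', ''j'', ''dn'', ''x'', ''via''}" "rwrites dijkstra = {''L''}"
  by (auto simp: dijkstra_def)

section \<open>Shortest-path labels on the columns and their invariant\<close>

context solver
begin

text \<open>Equivalently, every move of a placed row has nonnegative reduced length
  \<open>(d r k - d r j) - (y k - y j)\<close>.\<close>

definition dual_feasible :: "(nat \<Rightarrow> nat) \<Rightarrow> (nat \<Rightarrow> real) \<Rightarrow> bool" where
  "dual_feasible a y \<longleftrightarrow> (\<forall>r<n. \<forall>j<K. \<forall>k<K. a r = Suc j \<longrightarrow> d r j - y j \<le> d r k - y k)"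

text \<open>Dijkstra's invariant after \<open>m\<close> rounds. The triangle inequality is claimed
  for finished targets \<open>k\<close> too, which the program does not relax; this is what makes
  \<open>L\<close> a feasible potential when all columns are finished. The last clause says that
  each label is attained, by the new row directly or through a finished column, of smaller rank if
  \<open>k\<close> is finished itself.\<close>

definition labels :: "nat \<Rightarrow> (nat \<Rightarrow> nat) \<Rightarrow> (nat \<Rightarrow> real) \<Rightarrow> nat \<Rightarrow> (nat \<Rightarrow> nat) \<Rightarrow> (nat \<Rightarrow> real) \<Rightarrow> (nat \<Rightarrow> nat) \<Rightarrow> bool" where
  "labels i a y m dn L via \<longleftrightarrow>
    (\<forall>k<K. dn k \<le> m) \<and> card {k. k < K \<and> dn k \<noteq> 0} = m \<and>
    (\<forall>j<K. \<forall>k<K. dn j \<noteq> 0 \<and> dn k = 0 \<longrightarrow> L j - y j \<le> L k - y k) \<and>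
    (\<forall>r<n. \<forall>j<K. \<forall>k<K. a r = Suc j \<and> dn j \<noteq> 0 \<longrightarrow> L k \<le> L j + (d r k - d r j)) \<and>
    (\<forall>k<K. L k \<le> d i k) \<and>
    (\<forall>k<K. via k = i \<and> L k = d i k \<or> (\<exists>j<K. via k < n \<and> a (via k) = Suc j \<and> dn j \<noteq> 0 \<and>
       L k = L j + (d (via k) k - d (via k) j) \<and> (dn k \<noteq> 0 \<longrightarrow> dn j < dn k)))"

text \<open>The effect of one relaxation pass from \<open>j\<close> on column \<open>k\<close>, with
  the old and new label \<open>l\<close>, \<open>l'\<close> and the old and new row
  \<open>v\<close>, \<open>v'\<close>. Stating it without the memory separates
  \<open>labels_step\<close> from the program.\<close>

definition relaxed :: "nat \<Rightarrow> (nat \<Rightarrow> nat) \<Rightarrow> (nat \<Rightarrow> nat) \<Rightarrow> (nat \<Rightarrow> real) \<Rightarrow> nat \<Rightarrow> real \<Rightarrow> real \<Rightarrow> nat \<Rightarrow> nat \<Rightarrow> bool" where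
  "relaxed j a dn L k l l' v v' \<longleftrightarrow>
    l' = l \<and> v' = v \<and> (dn k = 0 \<longrightarrow> (\<forall>r<n. a r = Suc j \<longrightarrow> l \<le> L j + (d r k - d r j))) \<or>
    dn k = 0 \<and> v' < n \<and> a v' = Suc j \<and> l' = L j + (d v' k - d v' j) \<and> l' \<le> l \<and>
      (\<forall>r<n. a r = Suc j \<longrightarrow> d v' k - d v' j \<le> d r k - d r j)"

lemma labelsD:
  assumes "labels i a y m dn L via"
  shows "k < K \<Longrightarrow> dn k \<le> m" "card {k. k < K \<and> dn k \<noteq> 0} = m"
    "j < K \<Longrightarrow> k < K \<Longrightarrow> dn j \<noteq> 0 \<Longrightarrow> dn k = 0 \<Longrightarrow> L j - y j \<le> L k - y k"
    "r < n \<Longrightarrow> j < K \<Longrightarrow> k < K \<Longrightarrow> a r = Suc j \<Longrightarrow> dn j \<noteq> 0 \<Longrightarrow> L k \<le> L j + (d r k - d r j)"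
    "k < K \<Longrightarrow> L k \<le> d i k"
    "k < K \<Longrightarrow> via k = i \<and> L k = d i k \<or> (\<exists>j<K. via k < n \<and> a (via k) = Suc j \<and> dn j \<noteq> 0 \<and>
       L k = L j + (d (via k) k - d (via k) j) \<and> (dn k \<noteq> 0 \<longrightarrow> dn j < dn k))"
  using assms unfolding labels_def by blast+

text \<open>Reduced lengths are nonnegative, so a path through \<open>j\<close> cannot push a
  reduced label below that of \<open>j\<close> (fact \<open>low\<close>). Hence finished columns
  keep the smallest reduced distances and never need another relaxation.\<close>

lemma labels_step:
  assumes lab: "labels i a y m dn L via" and dual: "dual_feasible a y"
    and j: "j < K" "dn j = 0" and min: "\<And>k. k < K \<Longrightarrow> dn k = 0 \<Longrightarrow> L j - y j \<le> L k - y k"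
    and rel: "\<And>k. k < K \<Longrightarrow> relaxed j a (dn(j := Suc m)) L k (L k) (L' k) (via k) (via' k)"
  shows "labels i a y (Suc m) (dn(j := Suc m)) L' via'"
proof -
  let ?dn = "dn(j := Suc m)"
  note old = labelsD[OF lab]
  have fixed: "L' k = L k" "via' k = via k" if "k < K" "?dn k \<noteq> 0" for k
    using rel[OF that(1)] that(2) by (auto simp: relaxed_def)
  have le: "L' k \<le> L k" if "k < K" for k
    using rel[OF that] by (auto simp: relaxed_def)
  have y: "y k - y j \<le> d r k - d r j" if "r < n" "a r = Suc j" "k < K" for r k
    using dual that j unfolding dual_feasible_def by fastforce
  have new: "L' k \<le> L j + (d r k - d r j)" if "k < K" "?dn k = 0" "r < n" "a r = Suc j" for k r
  proof -
    have "L k \<le> L j + (d r k - d r j) \<and> L' k = L k \<or> L' k = L j + (d (via' k) k - d (via' k) j) \<and> d (via' k) k - d (via' k) j \<le> d r k - d r j"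
      using rel[OF that(1)] that(2-) unfolding relaxed_def by metis
    then show ?thesis by linarith
  qed
  have low: "L j - y j \<le> L' k - y k" if "k < K" "?dn k = 0" for k
  proof -
    have "L' k = L k \<or> (\<exists>r<n. a r = Suc j \<and> L' k = L j + (d r k - d r j))"
      using rel[OF that(1)] unfolding relaxed_def by blast
    moreover have "dn k = 0" using that(2) by (auto split: if_splits)
    ultimately show ?thesis using min[OF that(1)] y[OF _ _ that(1)] by fastforce
  qed
  have 1: "?dn k \<le> Suc m" if "k < K" for k
    using old(1)[OF that] by simp
  have "{k. k < K \<and> ?dn k \<noteq> 0} = insert j {k. k < K \<and> dn k \<noteq> 0}"
    using j by auto
  then have 2: "card {k. k < K \<and> ?dn k \<noteq> 0} = Suc m"
    using old(2) j by simp
  have 3: "L' j' - y j' \<le> L' k - y k" if "j' < K" "k < K" "?dn j' \<noteq> 0" "?dn k = 0" for j' k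
  proof (cases "j' = j")
    case True
    then show ?thesis using low that fixed j by simp
  next
    case False
    then have "L j' - y j' \<le> L j - y j" using old(3) that j by auto
    then show ?thesis using low[OF that(2,4)] fixed(1)[OF that(1,3)] by linarith
  qed
  have 4: "L' k \<le> L' j' + (d r k - d r j')" if "r < n" "j' < K" "k < K" "a r = Suc j'" "?dn j' \<noteq> 0" for r j' k
  proof (cases "j' = j")
    case False
    then have "L k \<le> L j' + (d r k - d r j')" using old(4) that by auto
    then show ?thesis using le[OF that(3)] fixed(1)[OF that(2,5)] by linarith
  next
    case True
    \<comment> \<open>Unfinished targets have just been relaxed, and \<open>j\<close> itself is
      trivial. An earlier finished target satisfies the inequality already, because its reduced
      distance is at most that of \<open>j\<close> and the move has nonnegative reduced
      length.\<close>
    consider "?dn k = 0" | "k = j" | "dn k \<noteq> 0" "?dn k \<noteq> 0" by fastforce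
    then show ?thesis
    proof cases
      case 1
      then show ?thesis using new that True fixed(1)[of j] j by auto
    next
      case 3
      then have "L k - y k \<le> L j - y j" using old(3) that j by auto
      then show ?thesis using y[of r k] that True fixed(1)[OF that(3) 3(2)] fixed(1)[of j] j by auto
    qed (use True in auto)
  qed
  have 5: "L' k \<le> d i k" if "k < K" for k
    using le[OF that] old(5)[OF that] by linarith
  have 6: "via' k = i \<and> L' k = d i k \<or> (\<exists>j'<K. via' k < n \<and> a (via' k) = Suc j' \<and> ?dn j' \<noteq> 0 \<and>
       L' k = L' j' + (d (via' k) k - d (via' k) j') \<and> (?dn k \<noteq> 0 \<longrightarrow> ?dn j' < ?dn k))" if k: "k < K" for k
  proof (cases "L' k = L k \<and> via' k = via k")
    case True
    have "via k = i \<and> L k = d i k \<or> (\<exists>j<K. via k < n \<and> a (via k) = Suc j \<and> dn j \<noteq> 0 \<and>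
       L k = L j + (d (via k) k - d (via k) j) \<and> (dn k \<noteq> 0 \<longrightarrow> dn j < dn k))"
      by (rule old(6)[OF k])
    then show ?thesis
    proof
      assume "via k = i \<and> L k = d i k"
      then show ?thesis using True by simp
    next
      assume "\<exists>j<K. via k < n \<and> a (via k) = Suc j \<and> dn j \<noteq> 0 \<and>
       L k = L j + (d (via k) k - d (via k) j) \<and> (dn k \<noteq> 0 \<longrightarrow> dn j < dn k)"
      then obtain j' where j': "j' < K" "via k < n" "a (via k) = Suc j'" "dn j' \<noteq> 0"
        "L k = L j' + (d (via k) k - d (via k) j')" "dn k \<noteq> 0 \<longrightarrow> dn j' < dn k" by blast
      have ne: "j' \<noteq> j" using j' j by auto
      have "L' j' = L j'" using fixed(1)[OF j'(1)] ne j'(4) by simp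
      moreover have "?dn k \<noteq> 0 \<longrightarrow> ?dn j' < ?dn k"
        using j'(6) old(1)[OF j'(1)] ne by auto
      ultimately show ?thesis
        using True j' ne by (intro disjI2 exI[of _ j']) simp
    qed
  next
    case False
    then have "?dn k = 0" "via' k < n" "a (via' k) = Suc j" "L' k = L j + (d (via' k) k - d (via' k) j)"
      using rel[OF k] unfolding relaxed_def by auto
    moreover have "L' j = L j" using fixed(1) j by simp
    ultimately show ?thesis using j by (intro disjI2 exI[of _ j]) simp
  qed
  show ?thesis
    unfolding labels_def using 1 2 3 4 5 6 by blast
qed

text \<open>These facts justify the augmentation: rows that stay are optimal for the potential
  \<open>L\<close> by the first conclusion, and a row moved into \<open>k\<close> is
  \<open>via k\<close>, which is optimal there by the last one. Both hold for all columns, whichever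
  one ends the path.\<close>

lemma labels_final:
  assumes lab: "labels i a y K dn L via" and "a i = 0" "i < n"
  shows "dual_feasible a L"
    and "k < K \<Longrightarrow> via k < n" "k < K \<Longrightarrow> 0 < dn k" "k < K \<Longrightarrow> dn k \<le> K"
    and "k < K \<Longrightarrow> via k = i \<or> (\<exists>j<K. a (via k) = Suc j \<and> dn j < dn k)"
    and "k < K \<Longrightarrow> k' < K \<Longrightarrow> d (via k) k - L k \<le> d (via k) k' - L k'"
proof -
  have "{k. k < K \<and> dn k \<noteq> 0} = {..<K}"
    by (rule card_subset_eq) (use labelsD(2)[OF lab] in auto)
  then have dn: "dn k \<noteq> 0" if "k < K" for k using that by auto
  then show "k < K \<Longrightarrow> 0 < dn k" by simp
  show "k < K \<Longrightarrow> dn k \<le> K" by (rule labelsD(1)[OF lab])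
  have le: "L k \<le> L j + (d r k - d r j)" if "r < n" "j < K" "k < K" "a r = Suc j" for r j k
    by (rule labelsD(4)[OF lab that]) (use dn that in blast)
  show "dual_feasible a L"
    using le unfolding dual_feasible_def by fastforce
  have v: "via k = i \<and> L k = d i k \<or> (\<exists>j<K. via k < n \<and> a (via k) = Suc j \<and>
       L k = L j + (d (via k) k - d (via k) j) \<and> dn j < dn k)" if "k < K" for k
    using labelsD(6)[OF lab that] dn[OF that] by blast
  show "k < K \<Longrightarrow> via k < n" "k < K \<Longrightarrow> via k = i \<or> (\<exists>j<K. a (via k) = Suc j \<and> dn j < dn k)"
    using v[of k] \<open>i < n\<close> by auto
  assume k: "k < K" "k' < K"
  from v[OF k(1)] show "d (via k) k - L k \<le> d (via k) k' - L k'"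
  proof
    assume "via k = i \<and> L k = d i k"
    moreover have "L k' \<le> d i k'" by (rule labelsD(5)[OF lab k(2)])
    ultimately show ?thesis by simp
  next
    assume "\<exists>j<K. via k < n \<and> a (via k) = Suc j \<and> L k = L j + (d (via k) k - d (via k) j) \<and> dn j < dn k"
    then obtain j where "j < K" "via k < n" "a (via k) = Suc j" "L k = L j + (d (via k) k - d (via k) j)" by blast
    with le[of "via k" j k'] k show ?thesis by simp
  qed
qed

lemma runs_sel:
  assumes inst: "inst s" and ex: "\<exists>k<K. fst s ''dn'' k = 0"
  shows "runs W sel s (100 * K + 20) (\<lambda>s'. \<exists>j<K. fst s' ''f'' 0 = Suc j \<and> fst s ''dn'' j = 0 \<and>
    (\<forall>k<K. fst s ''dn'' k = 0 \<longrightarrow> snd s ''L'' j - snd s ''y'' j \<le> snd s ''L'' k - snd s ''y'' k))"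
proof -
  define dn u where "dn = fst s ''dn''" and "u k = snd s ''L'' k - snd s ''y'' k" for k
  define I where "I k s' \<longleftrightarrow> fst s' ''dn'' = dn \<and> (\<forall>k. snd s' ''L'' k - snd s' ''y'' k = u k) \<and>
    (fst s' ''f'' 0 = 0 \<and> (\<forall>k'<k. dn k' \<noteq> 0) \<or>
     (\<exists>j<K. fst s' ''f'' 0 = Suc j \<and> dn j = 0 \<and> (\<forall>k'<k. dn k' = 0 \<longrightarrow> u j \<le> u k')))" for k s'
  let ?s = "nstore ''f'' 0 0 s"
  have KW: "K \<le> W" using Kn W_ge n2 by linarith
  have "runs W (For ''k'' ''K'' sel_step) ?s (100 * K + 10) (I K)"
  proof (rule runs_For[where N = K and T = 60])
    show "I 0 (nstore ''k'' 0 0 ?s)" by (simp add: I_def dn_def u_def)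
    show "fst ?s ''K'' 0 = K" using inst by (simp add: inst_def)
    fix k s1 assume k: "k < K" and I: "I k s1" and e: "fst s1 ''k'' 0 = k"
    have e': "fst s1 ''dn'' = dn" "\<And>k. snd s1 ''L'' k - snd s1 ''y'' k = u k"
      using I by (auto simp: I_def)
    have kW: "Suc k \<le> W" using k KW by simp
    consider "fst s1 ''f'' 0 = 0" "\<forall>k'<k. dn k' \<noteq> 0" |
      j where "j < K" "fst s1 ''f'' 0 = Suc j" "dn j = 0" "\<forall>k'<k. dn k' = 0 \<longrightarrow> u j \<le> u k'"
      using I by (auto simp: I_def)
    then show "runs W sel_step s1 60 (\<lambda>s'. I (Suc k) (nstore ''k'' 0 (Suc k) s'))"
    proof cases
      case 1
      show ?thesis unfolding sel_step_def
        using k 1(2) by (intro runs_intros) (auto simp: e e' kW 1(1) I_def less_Suc_eq)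
    next
      case (2 j)
      show ?thesis unfolding sel_step_def
        using k 2(1,3,4) by (intro runs_intros) (auto simp: e e' kW 2(2) I_def less_Suc_eq intro: order.trans less_imp_le)
    qed
  qed (use KW in \<open>auto simp: sel_step_def\<close>)
  then have "runs W (For ''k'' ''K'' sel_step) ?s (100 * K + 10) (\<lambda>s'. \<exists>j<K. fst s' ''f'' 0 = Suc j \<and> dn j = 0 \<and>
    (\<forall>k<K. dn k = 0 \<longrightarrow> u j \<le> u k))"
    by (rule runs_conseq) (use ex in \<open>auto simp: I_def dn_def\<close>)
  then have "runs W (For ''k'' ''K'' sel_step) ?s T (\<lambda>s'. \<exists>j<K. fst s' ''f'' 0 = Suc j \<and> dn j = 0 \<and>
    (\<forall>k<K. dn k = 0 \<longrightarrow> u j \<le> u k))" if "100 * K + 10 \<le> T" for T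
    by (rule runs_conseq) (use that in auto)
  from this[simplified] show ?thesis
    unfolding sel_def by (intro runs_NStore_Seq) (simp_all add: dn_def u_def)
qed

lemma runs_relax:
  assumes inst: "inst s" and f: "forest (\<lambda>j c x. a x = Suc j) (0, 0, 0) (fst s ''T'')"
    and j: "j < K" "fst s ''j'' 0 = j" "fst s ''dn'' j \<noteq> 0"
  shows "runs W (For ''k'' ''K'' relax_step) s (200 * K + 10) (\<lambda>s'. \<forall>k<K.
    relaxed j a (fst s ''dn'') (snd s ''L'') k (snd s ''L'' k) (snd s' ''L'' k) (fst s ''via'' k) (fst s' ''via'' k))"
proof -
  define dn L via T where "dn = fst s ''dn''" and "L = snd s ''L''" and "via = fst s ''via''" and "T = fst s ''T''"
  define I where "I m s' \<longleftrightarrow> inst s' \<and> fst s' ''j'' 0 = j \<and> fst s' ''dn'' = dn \<and> fst s' ''T'' = T \<and>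
    snd s' ''L'' j = L j \<and>
    (\<forall>k<K. if k < m then relaxed j a dn L k (L k) (snd s' ''L'' k) (via k) (fst s' ''via'' k)
      else snd s' ''L'' k = L k \<and> fst s' ''via'' k = via k)" for m s'
  have KW: "K \<le> W" using Kn W_ge n2 by linarith
  have "runs W (For ''k'' ''K'' relax_step) s (200 * K + 10) (I K)"
  proof (rule runs_For[where N = K and T = 150])
    show "I 0 (nstore ''k'' 0 0 s)" using inst j by (simp add: I_def dn_def L_def via_def T_def inst_def)
    show "fst s ''K'' 0 = K" using inst by (simp add: inst_def)
    fix k s1 assume k: "k < K" and I: "I k s1" and e: "fst s1 ''k'' 0 = k"
    have e': "fst s1 ''j'' 0 = j" "fst s1 ''dn'' = dn" "fst s1 ''T'' = T" "snd s1 ''L'' j = L j"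
      "snd s1 ''L'' k = L k" "fst s1 ''via'' k = via k" "fst s1 ''n'' 0 = n" "fst s1 ''K'' 0 = K" "snd s1 ''D'' = D"
      using I k by (auto simp: I_def inst_def)
    have I': "I (Suc k) s2" if "frame relax_step s1 s2" "fst s2 ''via'' = (fst s1 ''via'')(k := v)"
      "snd s2 ''L'' = (snd s1 ''L'')(k := l)" "relaxed j a dn L k (L k) l (via k) v" for s2 v l
    proof -
      \<comment> \<open>Column \<open>j\<close> is finished, so \<open>relaxed\<close> leaves its
        label alone and every round of the loop reads the same \<open>L j\<close>.\<close>
      have "l = L k" if "k = j"
        using \<open>relaxed j a dn L k (L k) l (via k) v\<close> that j(3) by (auto simp: relaxed_def dn_def)
      then show ?thesis
        using I that by (auto simp: I_def frame_def inst_def less_Suc_eq)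
    qed
    define x where "x = T (addr j k 1)"
    have x: "x = 0 \<and> (\<forall>r<n. a r \<noteq> Suc j) \<or>
      (\<exists>r<n. x = Suc r \<and> a r = Suc j \<and> (\<forall>r'<n. a r' = Suc j \<longrightarrow> d r k - d r j \<le> d r' k - d r' j))"
      using forest_root[OF f j(1) k] by (simp add: x_def T_def)
    have xe: "T (Suc ((j * K + k) * (2 * n))) = x" by (simp add: x_def addr_def)
    have xW: "x \<le> W" "x - Suc 0 \<le> W"
      using x W_ge n2 by auto
    have *: "runs W relax_step s1 150 (\<lambda>s2. \<exists>l v. fst s2 ''via'' = (fst s1 ''via'')(k := v) \<and>
      snd s2 ''L'' = (snd s1 ''L'')(k := l) \<and> relaxed j a dn L k (L k) l (via k) v)"
    proof (cases "dn k = 0")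
      case False
      then have "relaxed j a dn L k (L k) (L k) (via k) (via k)" by (simp add: relaxed_def)
      then show ?thesis unfolding relax_step_def using False
        by (intro runs_intros) (auto simp: e e' intro!: exI[of _ "L k"] exI[of _ "via k"])
    next
      case True
      show ?thesis
      proof (cases "x = 0 \<or> L k \<le> L j + (d (x - 1) k - d (x - 1) j)")
        case c: True
        then have "relaxed j a dn L k (L k) (L k) (via k) (via k)"
          using x by (fastforce simp: relaxed_def)
        moreover have "\<not> (0 < x \<and> L j + (D ((x - Suc 0) * K + k) - D ((x - Suc 0) * K + j)) < L k)"
          using c by (auto simp: d_def)
        ultimately show ?thesis unfolding relax_step_def cand_def
          by (intro runs_intros) (auto simp: e e' xe xW True intro!: exI[of _ "L k"] exI[of _ "via k"])
      next
        case c: False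
        then have "relaxed j a dn L k (L k) (L j + (d (x - 1) k - d (x - 1) j)) (via k) (x - 1)"
          using x True by (auto simp: relaxed_def)
        moreover have "0 < x \<and> L j + (D ((x - Suc 0) * K + k) - D ((x - Suc 0) * K + j)) < L k"
          using c by (auto simp: d_def)
        ultimately show ?thesis unfolding relax_step_def cand_def
          by (intro runs_intros) (auto simp: e e' xe xW True d_def intro!: exI[of _ "L j + (d (x - 1) k - d (x - 1) j)"] exI[of _ "x - 1"])
      qed
    qed
    have J: "I m (nstore ''k'' 0 u s2)" if "I m s2" for m u s2
      using that by (simp add: I_def inst_def)
    show "runs W relax_step s1 150 (\<lambda>s'. I (Suc k) (nstore ''k'' 0 (Suc k) s'))"
      by (rule runs_conseq[OF *]) (auto intro: J I')
  qed (use KW in auto)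
  then show ?thesis
    by (rule runs_conseq) (auto simp: I_def dn_def L_def via_def)
qed

definition dijkstra_inv where
  "dijkstra_inv i m s \<longleftrightarrow> inst s \<and> forest (\<lambda>j c x. fst s ''asg'' x = Suc j) (0, 0, 0) (fst s ''T'') \<and>
     dual_feasible (fst s ''asg'') (snd s ''y'') \<and>
     labels i (fst s ''asg'') (snd s ''y'') m (fst s ''dn'') (snd s ''L'') (fst s ''via'')"

lemma runs_dijkstra_step:
  assumes inv: "dijkstra_inv i m s" and m: "m < K" "fst s ''s'' 0 = m"
  shows "runs W dijkstra_step s (300 * K + 60) (dijkstra_inv i (Suc m))"
proof -
  define a y dn L via where "a = fst s ''asg''" and "y = snd s ''y''" and "dn = fst s ''dn''"
    and "L = snd s ''L''" and "via = fst s ''via''"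
  have e: "fst s ''asg'' = a" "snd s ''y'' = y" "fst s ''dn'' = dn" "snd s ''L'' = L" "fst s ''via'' = via"
    by (simp_all add: a_def y_def dn_def L_def via_def)
  have inst: "inst s" and f: "forest (\<lambda>j c x. a x = Suc j) (0, 0, 0) (fst s ''T'')"
    and dual: "dual_feasible a y" and lab: "labels i a y m dn L via"
    using inv by (simp_all add: dijkstra_inv_def e)
  have "\<exists>k<K. dn k = 0"
  proof (rule ccontr)
    assume "\<not> ?thesis"
    then have "{k. k < K \<and> dn k \<noteq> 0} = {..<K}" by auto
    then show False using lab m(1) by (simp add: labels_def)
  qed
  then have sel: "runs W sel s (100 * K + 20) (\<lambda>s'. \<exists>j<K. fst s' ''f'' 0 = Suc j \<and> dn j = 0 \<and>
    (\<forall>k<K. dn k = 0 \<longrightarrow> L j - y j \<le> L k - y k))"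
    using runs_sel[OF inst] by (simp add: e)
  show ?thesis
    unfolding dijkstra_step_def
  proof (rule runs_Seq[OF sel, where U = "200 * K + 40"])
    fix s1 assume fr: "frame sel s s1" and "\<exists>j<K. fst s1 ''f'' 0 = Suc j \<and> dn j = 0 \<and>
      (\<forall>k<K. dn k = 0 \<longrightarrow> L j - y j \<le> L k - y k)"
    then obtain j where j: "j < K" "fst s1 ''f'' 0 = Suc j" "dn j = 0"
      "\<And>k. k < K \<Longrightarrow> dn k = 0 \<Longrightarrow> L j - y j \<le> L k - y k" by blast
    have e1: "fst s1 ''asg'' = a" "snd s1 ''y'' = y" "fst s1 ''dn'' = dn" "snd s1 ''L'' = L" "fst s1 ''via'' = via"
      "fst s1 ''s'' 0 = m" "fst s1 ''T'' = fst s ''T''" "fst s1 ''n'' 0 = n" "fst s1 ''K'' 0 = K" "snd s1 ''D'' = D"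
      using fr inst m by (simp_all add: frame_def e inst_def)
    define dn' where "dn' = dn(j := Suc m)"
    let ?s2 = "nstore ''dn'' j (Suc m) (nstore ''j'' 0 j s1)"
    have "runs W (For ''k'' ''K'' relax_step) ?s2 (200 * K + 10) (\<lambda>s'. \<forall>k<K.
      relaxed j a (fst ?s2 ''dn'') (snd ?s2 ''L'') k (snd ?s2 ''L'' k) (snd s' ''L'' k) (fst ?s2 ''via'' k) (fst s' ''via'' k))"
      by (rule runs_relax) (use j f in \<open>simp_all add: inst_def e1\<close>)
    then have r: "runs W (For ''k'' ''K'' relax_step) ?s2 (200 * K + 10) (\<lambda>s'. \<forall>k<K.
      relaxed j a dn' L k (L k) (snd s' ''L'' k) (via k) (fst s' ''via'' k))"
      by (simp add: e1 dn'_def)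
    have r: "runs W (For ''k'' ''K'' relax_step) ?s2 U (dijkstra_inv i (Suc m))" if "200 * K + 10 \<le> U" for U
    proof (rule runs_conseq[OF r])
      fix s' assume rel: "\<forall>k<K. relaxed j a dn' L k (L k) (snd s' ''L'' k) (via k) (fst s' ''via'' k)"
        and fr: "frame (For ''k'' ''K'' relax_step) ?s2 s'"
      have e2: "fst s' ''asg'' = a" "snd s' ''y'' = y" "fst s' ''dn'' = dn'"
        "fst s' ''T'' = fst s ''T''" "fst s' ''n'' 0 = n" "fst s' ''K'' 0 = K" "snd s' ''D'' = D"
        using fr by (simp_all add: frame_def e1 dn'_def)
      have "labels i a y (Suc m) dn' (snd s' ''L'') (fst s' ''via'')"
        unfolding dn'_def by (rule labels_step[OF lab dual j(1,3,4)]) (use rel dn'_def in auto)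
      then show "dijkstra_inv i (Suc m) s'"
        using dual f by (simp add: dijkstra_inv_def e2 inst_def)
    qed (use that in auto)
    have "j \<le> W" "Suc m \<le> W" using j m Kn W_ge n2 by linarith+
    then show "runs W (Seq (st ''j'' (NSub (sc ''f'') (NConst 1)))
      (Seq (NStore ''dn'' (sc ''j'') (NAdd (sc ''s'') (NConst 1))) (For ''k'' ''K'' relax_step))) s1
      (200 * K + 40) (dijkstra_inv i (Suc m))"
      by (intro runs_NStore_Seq) (simp_all add: e1 j(2) r[simplified])
  qed simp
qed

lemma runs_dijkstra:
  assumes "dijkstra_inv i 0 s"
  shows "runs W dijkstra s (K * (300 * K + 100) + 10) (dijkstra_inv i K)"
proof -
  have J: "dijkstra_inv i m (nstore ''s'' 0 u s)" if "dijkstra_inv i m s" for m u s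
    using that by (simp add: dijkstra_inv_def inst_def)
  show ?thesis
    unfolding dijkstra_def
  proof (rule runs_For[where I = "dijkstra_inv i" and N = K and T = "300 * K + 60"])
    show "fst s ''K'' 0 = K" using assms by (simp add: dijkstra_inv_def inst_def)
    show "K \<le> W" using Kn W_ge n2 by linarith
    fix m s1 assume "m < K" "dijkstra_inv i m s1" "fst s1 ''s'' 0 = m"
    then show "runs W dijkstra_step s1 (300 * K + 60) (\<lambda>s'. dijkstra_inv i (Suc m) (nstore ''s'' 0 (Suc m) s'))"
      by (intro runs_conseq[OF runs_dijkstra_step]) (auto intro: J)
  qed (use assms J in auto)
qed

end

section \<open>The assignment algorithm\<close>

definition init_step :: com where
  "init_step = Seq (RStore ''L'' (sc ''k'') (RRead ''D'' (NAdd (NMul (sc ''i'') (sc ''K'')) (sc ''k''))))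
    (Seq (NStore ''via'' (sc ''k'') (sc ''i'')) (NStore ''dn'' (sc ''k'') (NConst 0)))"

definition copy_step :: com where
  "copy_step = RStore ''y'' (sc ''k'') (RRead ''L'' (sc ''k''))"

text \<open>During the run \<open>pi\<close> holds the remaining capacities. The loop settles on the
  last column that has some left.\<close>

definition find_step :: com where
  "find_step = Cond (NLess (NConst 0) (NRead ''pi'' (sc ''k''))) (st ''h'' (NAdd (sc ''k'') (NConst 1))) Skip"

definition phase :: com where
  "phase = Seq (For ''k'' ''K'' init_step) (Seq dijkstra (Seq (For ''k'' ''K'' copy_step)
    (Seq (For ''k'' ''K'' find_step)
    (Seq (NStore ''pi'' (NSub (sc ''h'') (NConst 1)) (NSub (NRead ''pi'' (NSub (sc ''h'') (NConst 1))) (NConst 1)))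
      aug))))"

definition out_step :: com where
  "out_step = NStore ''out'' (NAdd (NMul (sc ''i'') (sc ''K'')) (NSub (NRead ''asg'' (sc ''i'')) (NConst 1))) (NConst 1)"

definition assign :: com where
  "assign = Seq (For ''i'' ''n'' phase) (For ''i'' ''n'' out_step)"

lemma writes_steps [simp]:
  "nwrites init_step = {''via'', ''dn''}" "rwrites init_step = {''L''}"
  "nwrites copy_step = {}" "rwrites copy_step = {''y''}"
  "nwrites find_step = {''h''}" "rwrites find_step = {}"
  "nwrites out_step = {''out''}" "rwrites out_step = {}"
  by (auto simp: init_step_def copy_step_def find_step_def out_step_def)

lemma writes_phase [simp]:
  "nwrites phase = {''k'', ''via'', ''dn'', ''s'', ''f'', ''j'', ''x'', ''h'', ''pi'', ''r'', ''q'', ''v'',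
    ''asg'', ''c'', ''b'', ''p'', ''T'', ''z''}" "rwrites phase = {''L'', ''y''}"
  by (auto simp: phase_def)

section \<open>Correctness of one insertion and of the whole algorithm\<close>

context solver
begin

lemma KW: "K \<le> W" using Kn W_ge n2 by linarith

lemma runs_init:
  assumes inst: "inst s" and i: "fst s ''i'' 0 = i" "i < n"
  shows "runs W (For ''k'' ''K'' init_step) s (100 * K + 10)
    (\<lambda>s'. \<forall>k<K. snd s' ''L'' k = d i k \<and> fst s' ''via'' k = i \<and> fst s' ''dn'' k = 0)"
proof -
  define I where "I m s' \<longleftrightarrow> inst s' \<and> fst s' ''i'' 0 = i \<and>
    (\<forall>k<m. snd s' ''L'' k = d i k \<and> fst s' ''via'' k = i \<and> fst s' ''dn'' k = 0)" for m s'
  have "runs W (For ''k'' ''K'' init_step) s (100 * K + 10) (I K)"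
  proof (rule runs_For[where I = I and N = K and T = 50])
    show "I 0 (nstore ''k'' 0 0 s)" using inst i by (simp add: I_def inst_def)
    show "fst s ''K'' 0 = K" using inst by (simp add: inst_def)
    fix k s1 assume k: "k < K" and I: "I k s1" and ek: "fst s1 ''k'' 0 = k"
    have e: "fst s1 ''i'' 0 = i" "fst s1 ''n'' 0 = n" "fst s1 ''K'' 0 = K" "snd s1 ''D'' = D"
      using I by (simp_all add: I_def inst_def)
    have "i \<le> W" using i W_ge n2 by linarith
    then show "runs W init_step s1 50 (\<lambda>s'. I (Suc k) (nstore ''k'' 0 (Suc k) s'))"
      unfolding init_step_def using I
      by (intro runs_intros) (auto simp: ek e I_def inst_def d_def less_Suc_eq)
  qed (use KW in auto)
  then show ?thesis by (rule runs_conseq) (auto simp: I_def)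
qed

lemma runs_copy:
  assumes inst: "inst s"
  shows "runs W (For ''k'' ''K'' copy_step) s (100 * K + 10) (\<lambda>s'. \<forall>k<K. snd s' ''y'' k = snd s ''L'' k)"
proof -
  define L where "L = snd s ''L''"
  define I where "I m s' \<longleftrightarrow> snd s' ''L'' = L \<and> (\<forall>k<m. snd s' ''y'' k = L k)" for m and s' :: memory
  have "runs W (For ''k'' ''K'' copy_step) s (100 * K + 10) (I K)"
  proof (rule runs_For[where I = I and N = K and T = 50])
    show "I 0 (nstore ''k'' 0 0 s)" by (simp add: I_def L_def)
    show "fst s ''K'' 0 = K" using inst by (simp add: inst_def)
    fix k s1 assume I: "I k s1" and ek: "fst s1 ''k'' 0 = k"
    show "runs W copy_step s1 50 (\<lambda>s'. I (Suc k) (nstore ''k'' 0 (Suc k) s'))"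
      unfolding copy_step_def using I
      by (intro runs_intros) (auto simp: ek I_def less_Suc_eq)
  qed (use KW in auto)
  then show ?thesis by (rule runs_conseq) (auto simp: I_def L_def)
qed

lemma runs_find:
  assumes inst: "inst s" and ex: "\<exists>k<K. 0 < fst s ''pi'' k"
  shows "runs W (For ''k'' ''K'' find_step) s (100 * K + 10)
    (\<lambda>s'. \<exists>t<K. fst s' ''h'' 0 = Suc t \<and> 0 < fst s ''pi'' t)"
proof -
  define p where "p = fst s ''pi''"
  define I where "I m s' \<longleftrightarrow> fst s' ''pi'' = p \<and>
    ((\<exists>k<m. 0 < p k) \<longrightarrow> (\<exists>t<K. fst s' ''h'' 0 = Suc t \<and> 0 < p t))" for m and s' :: memory
  have "runs W (For ''k'' ''K'' find_step) s (100 * K + 10) (I K)"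
  proof (rule runs_For[where I = I and N = K and T = 50])
    show "I 0 (nstore ''k'' 0 0 s)" by (simp add: I_def p_def)
    show "fst s ''K'' 0 = K" using inst by (simp add: inst_def)
    fix k s1 assume k: "k < K" and I: "I k s1" and ek: "fst s1 ''k'' 0 = k"
    have e: "fst s1 ''pi'' = p" using I by (simp add: I_def)
    have "Suc k \<le> W" using KW k by simp
    then show "runs W find_step s1 50 (\<lambda>s'. I (Suc k) (nstore ''k'' 0 (Suc k) s'))"
      unfolding find_step_def using I k
      by (intro runs_intros) (auto simp: ek e I_def less_Suc_eq)
  qed (use KW in auto)
  then show ?thesis by (rule runs_conseq) (use ex in \<open>auto simp: I_def p_def\<close>)
qed

definition main_inv where
  "main_inv \<pi> i s \<longleftrightarrow> inst s \<and> forest (\<lambda>j c x. fst s ''asg'' x = Suc j) (0, 0, 0) (fst s ''T'') \<and>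
     dual_feasible (fst s ''asg'') (snd s ''y'') \<and>
     (\<forall>r<n. fst s ''asg'' r \<noteq> 0 \<longleftrightarrow> r < i) \<and> (\<forall>r<n. fst s ''asg'' r \<le> K) \<and>
     (\<forall>c<K. card {x. x < n \<and> fst s ''asg'' x = Suc c} + fst s ''pi'' c = \<pi> c)"

lemma sum_card_columns:
  fixes a :: "nat \<Rightarrow> nat"
  assumes "\<And>r. r < n \<Longrightarrow> a r \<le> K"
  shows "(\<Sum>c<K. card {x. x < n \<and> a x = Suc c}) = card {x. x < n \<and> a x \<noteq> 0}"
proof -
  have "c < K" if "x < n" "a x = Suc c" for x c
    using assms[OF that(1)] that(2) by simp
  then have "{x. x < n \<and> a x \<noteq> 0} = (\<Union>c\<in>{..<K}. {x. x < n \<and> a x = Suc c})"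
    by (fastforce simp: gr0_conv_Suc)
  also have "card \<dots> = (\<Sum>c<K. card {x. x < n \<and> a x = Suc c})"
    by (rule card_UN_disjoint) auto
  finally show ?thesis by simp
qed

abbreviation phase_time where
  "phase_time l \<equiv> 2000 * (K * K * Suc l)"

lemma phase_time:
  "3 * (100 * K + 10) + (K * (300 * K + 100) + 10) + (K * (2 * setcol_time l + 110) + 10) + 100 \<le> phase_time l"
proof -
  have "1 \<le> K" using K2 by simp
  then have "K * 1 \<le> K * K" "1 * 1 \<le> K * K" by (intro mult_le_mono; simp)+
  moreover have "K * K * 1 \<le> K * K * Suc l" by (intro mult_le_mono) simp_all
  ultimately have 1: "K \<le> K * K * Suc l" "1 \<le> K * K * Suc l" "K * K \<le> K * K * Suc l" by linarith+
  \<comment> \<open>The coefficients below add up to 1404, and each monomial is at most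
    \<open>K * K * Suc l\<close>; 2000 leaves room.\<close>
  have "3 * (100 * K + 10) + (K * (300 * K + 100) + 10) + (K * (2 * setcol_time l + 110) + 10) + 100
    = 400 * (K * K * Suc l) + 324 * (K * K) + 530 * K + 150"
    by (simp add: algebra_simps)
  with 1 show ?thesis by linarith
qed

lemma runs_phase:
  assumes inv: "main_inv \<pi> i s" and i: "fst s ''i'' 0 = i" "i < n" and l: "n < 2 ^ l"
    and \<pi>: "(\<Sum>c<K. \<pi> c) = n"
  shows "runs W phase s (phase_time l) (main_inv \<pi> (Suc i))"
proof -
  define a p where "a = fst s ''asg''" and "p = fst s ''pi''"
  have inst: "inst s" and f: "forest (\<lambda>j c x. a x = Suc j) (0, 0, 0) (fst s ''T'')"
    and dual: "dual_feasible a (snd s ''y'')" and dom: "\<And>r. r < n \<Longrightarrow> a r \<noteq> 0 \<longleftrightarrow> r < i"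
    and aK: "\<And>r. r < n \<Longrightarrow> a r \<le> K"
    and cnt: "\<And>c. c < K \<Longrightarrow> card {x. x < n \<and> a x = Suc c} + p c = \<pi> c"
    using inv by (simp_all add: main_inv_def a_def p_def)
  have e: "fst s ''asg'' = a" "fst s ''pi'' = p" "fst s ''n'' 0 = n" "fst s ''K'' 0 = K" "snd s ''D'' = D"
    using inst by (simp_all add: a_def p_def inst_def)
  have a0: "a i = 0" using dom[OF i(2)] by simp
  \<comment> \<open>Since \<open>i\<close> rows are placed and the demands add up to
    \<open>n\<close>, a capacity of \<open>n - i > 0\<close> is left, so some column can end the
    path.\<close>
  have "{x. x < n \<and> a x \<noteq> 0} = {..<i}" using dom i by auto
  then have "(\<Sum>c<K. card {x. x < n \<and> a x = Suc c}) = i"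
    using sum_card_columns[of a, OF aK] by simp
  moreover have "(\<Sum>c<K. card {x. x < n \<and> a x = Suc c}) + (\<Sum>c<K. p c) = n"
    using cnt \<pi> by (simp flip: sum.distrib)
  ultimately have "(\<Sum>c<K. p c) \<noteq> 0" using i by linarith
  then have pex: "\<exists>k<K. 0 < p k" by auto
  have p_le: "p c \<le> n" if "c < K" for c
  proof -
    have "\<pi> c \<le> (\<Sum>c<K. \<pi> c)" by (rule member_le_sum) (use that in auto)
    then show ?thesis using cnt[OF that] \<pi> by linarith
  qed
  let ?st = "NStore ''pi'' (NSub (sc ''h'') (NConst 1)) (NSub (NRead ''pi'' (NSub (sc ''h'') (NConst 1))) (NConst 1))"
  let ?t3 = "50 + (K * (2 * setcol_time l + 110) + 10)"
  let ?t2 = "(100 * K + 10) + ?t3"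
  let ?t1 = "(100 * K + 10) + ?t2"
  let ?t0 = "(K * (300 * K + 100) + 10) + ?t1"
  have "runs W phase s ((100 * K + 10) + ((K * (300 * K + 100) + 10) + ((100 * K + 10) + ((100 * K + 10) +
      (50 + (K * (2 * setcol_time l + 110) + 10)))))) (main_inv \<pi> (Suc i))"
    unfolding phase_def
  proof (rule runs_Seq[where U = ?t0, OF runs_init[OF inst i]], rule runs_Seq[where U = ?t1, OF runs_dijkstra])
    fix s1 assume L0: "\<forall>k<K. snd s1 ''L'' k = d i k \<and> fst s1 ''via'' k = i \<and> fst s1 ''dn'' k = 0"
      and fr: "frame (For ''k'' ''K'' init_step) s s1"
    have e1: "fst s1 ''asg'' = a" "fst s1 ''pi'' = p" "fst s1 ''n'' 0 = n" "fst s1 ''K'' 0 = K" "snd s1 ''D'' = D"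
      "fst s1 ''T'' = fst s ''T''" "snd s1 ''y'' = snd s ''y''"
      using fr by (simp_all add: frame_def e)
    have "{k. k < K \<and> fst s1 ''dn'' k \<noteq> 0} = {}" using L0 by auto
    then have "labels i a (snd s ''y'') 0 (fst s1 ''dn'') (snd s1 ''L'') (fst s1 ''via'')"
      using L0 by (simp add: labels_def)
    then show "dijkstra_inv i 0 s1"
      using f dual by (simp add: dijkstra_inv_def inst_def e1)
    fix s2 assume d2: "dijkstra_inv i K s2" and fr2: "frame dijkstra s1 s2"
    have e2: "fst s2 ''asg'' = a" "fst s2 ''pi'' = p" "fst s2 ''n'' 0 = n" "fst s2 ''K'' 0 = K" "snd s2 ''D'' = D"
      "fst s2 ''T'' = fst s ''T''" "snd s2 ''y'' = snd s ''y''"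
      using fr2 by (simp_all add: frame_def e1)
    define L via dn where "L = snd s2 ''L''" and "via = fst s2 ''via''" and "dn = fst s2 ''dn''"
    have "labels i a (snd s ''y'') K dn L via"
      using d2 by (simp add: dijkstra_inv_def e2 L_def via_def dn_def)
    note fin = labels_final[OF this a0 i(2)]
    have inst2: "inst s2" by (simp add: inst_def e2)
    show "runs W (Seq (For ''k'' ''K'' copy_step) (Seq (For ''k'' ''K'' find_step) (Seq ?st aug))) s2
      ((100 * K + 10) + ((100 * K + 10) + (50 + (K * (2 * setcol_time l + 110) + 10)))) (main_inv \<pi> (Suc i))"
    proof (rule runs_Seq[where U = ?t2, OF runs_copy[OF inst2]], rule runs_Seq[where U = ?t3, OF runs_find])
      fix s3 assume "\<forall>k<K. snd s3 ''y'' k = snd s2 ''L'' k" and fr3: "frame (For ''k'' ''K'' copy_step) s2 s3"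
      then have y: "snd s3 ''y'' k = L k" if "k < K" for k using that by (simp add: L_def)
      have e3: "fst s3 ''asg'' = a" "fst s3 ''pi'' = p" "fst s3 ''n'' 0 = n" "fst s3 ''K'' 0 = K" "snd s3 ''D'' = D"
        "fst s3 ''T'' = fst s ''T''" "fst s3 ''via'' = via" "fst s3 ''dn'' = dn"
        using fr3 by (simp_all add: frame_def e2 via_def dn_def)
      show "inst s3" by (simp add: inst_def e3)
      show "\<exists>k<K. 0 < fst s3 ''pi'' k" using pex by (simp add: e3)
      fix s4 assume "\<exists>t<K. fst s4 ''h'' 0 = Suc t \<and> 0 < fst s3 ''pi'' t"
        and fr4: "frame (For ''k'' ''K'' find_step) s3 s4"
      then obtain t where t: "t < K" "fst s4 ''h'' 0 = Suc t" "0 < p t" by (auto simp: e3)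
      have e4: "fst s4 ''asg'' = a" "fst s4 ''pi'' = p" "fst s4 ''n'' 0 = n" "fst s4 ''K'' 0 = K" "snd s4 ''D'' = D"
        "fst s4 ''T'' = fst s ''T''" "fst s4 ''via'' = via" "fst s4 ''dn'' = dn" "snd s4 ''y'' = snd s3 ''y''"
        using fr4 by (simp_all add: frame_def e3)
      have "p t - 1 \<le> W" using p_le[OF t(1)] W_ge n2 by linarith
      then have "p t - Suc 0 \<le> W" by simp
      let ?s5 = "nstore ''pi'' t (p t - 1) s4"
      have av: "aug_inv i t a via dn K ?s5"
        using f fin(4)[OF t(1)] fin(5) a0 t(1) by (auto simp: aug_inv_def path_inv_def inst_def e4 t(2))
      have via0: "a (via k) = 0 \<Longrightarrow> via k = i" if "k < K" for k
        using fin(5)[OF that] by auto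
      have "runs W aug ?s5 (K * (2 * setcol_time l + 110) + 10) (main_inv \<pi> (Suc i))"
      proof (rule runs_conseq[OF runs_aug[OF av i(2) a0 l]])
        fix s6 assume "forest (\<lambda>j c x. fst s6 ''asg'' x = Suc j) (0, 0, 0) (fst s6 ''T'') \<and>
          (\<exists>m. path_inv i t a via dn m 0 (fst s6 ''asg''))" and fr6: "frame aug ?s5 s6"
        then obtain m where f6: "forest (\<lambda>j c x. fst s6 ''asg'' x = Suc j) (0, 0, 0) (fst s6 ''T'')"
          and p6: "path_inv i t a via dn m 0 (fst s6 ''asg'')" by blast
        define a' where "a' = fst s6 ''asg''"
        have e6: "fst s6 ''n'' 0 = n" "fst s6 ''K'' 0 = K" "snd s6 ''D'' = D" "fst s6 ''asg'' = a'"
          "snd s6 ''y'' = snd s3 ''y''" "fst s6 ''pi'' = p(t := p t - 1)"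
          using fr6 by (simp_all add: frame_def e4 a'_def)
        have moved: "a' r = a r \<or> (\<exists>k<K. via k = r \<and> a' r = Suc k)" if "r < n" for r
          using p6 that unfolding path_inv_def a'_def by blast
        have dom': "a' r \<noteq> 0 \<longleftrightarrow> r < Suc i" if "r < n" for r
        proof -
          have "a' r \<noteq> 0 \<longleftrightarrow> a r \<noteq> 0 \<or> r = i"
            using p6 that unfolding path_inv_def a'_def by blast
          then show ?thesis using dom[OF that] by auto
        qed
        have "a' r \<le> K" if "r < n" for r
          using moved[OF that] aK[OF that] by auto
        moreover have "card {x. x < n \<and> a' x = Suc c} + (p(t := p t - 1)) c = \<pi> c" if "c < K" for c
        proof -
          have "card {x. x < n \<and> a' x = Suc c} = card {x. x < n \<and> a x = Suc c} + (if c = t then 1 else 0)"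
            using p6 that by (simp add: path_inv_def a'_def)
          then show ?thesis using cnt[OF that] t(3) by auto
        qed
        \<comment> \<open>A row that stays is covered by feasibility of \<open>L\<close> for the old
          assignment, a moved row by tightness of \<open>via\<close>. On the columns
          \<open>y\<close> now equals \<open>L\<close>.\<close>
        moreover have "dual_feasible a' (snd s3 ''y'')"
          unfolding dual_feasible_def
        proof (intro allI impI)
          fix r j k assume *: "r < n" "j < K" "k < K" "a' r = Suc j"
          from moved[OF *(1)] have "d r j - L j \<le> d r k - L k"
          proof
            assume "a' r = a r"
            then show ?thesis using fin(1) * unfolding dual_feasible_def by simp
          next
            assume "\<exists>k<K. via k = r \<and> a' r = Suc k"
            then have "via j = r" using *(4) by auto
            then show ?thesis using fin(6)[OF *(2,3)] by simp
          qed
          then show "d r j - snd s3 ''y'' j \<le> d r k - snd s3 ''y'' k" using y * by simp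
        qed
        ultimately show "main_inv \<pi> (Suc i) s6"
          using f6 dom' by (simp add: main_inv_def inst_def e6)
      qed (use fin(2,3) via0 in auto)
      then have *: "runs W aug ?s5 U (main_inv \<pi> (Suc i))" if "K * (2 * setcol_time l + 110) + 10 \<le> U" for U
        by (rule runs_conseq) (use that in auto)
      show "runs W (Seq ?st aug) s4 (50 + (K * (2 * setcol_time l + 110) + 10)) (main_inv \<pi> (Suc i))"
        by (intro runs_NStore_Seq) (simp_all add: e4 t(2) \<open>p t - Suc 0 \<le> W\<close> *[simplified])
    qed simp_all
  qed simp_all
  then show ?thesis
  proof (rule runs_conseq)
    show "100 * K + 10 + ?t0 \<le> phase_time l"
      by (rule order_trans[OF _ phase_time[of l]]) (simp add: algebra_simps)
  qed
qed

lemma runs_out: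
  assumes inst: "inst s" and out: "\<And>c. fst s ''out'' c = 0"
    and a: "\<And>r. r < n \<Longrightarrow> fst s ''asg'' r = Suc (a r) \<and> a r < K"
  shows "runs W (For ''i'' ''n'' out_step) s (100 * n + 10)
    (\<lambda>s'. \<forall>r<n. \<forall>k<K. fst s' ''out'' (r * K + k) = (if a r = k then 1 else 0))"
proof -
  define I where "I m s' \<longleftrightarrow> inst s' \<and> fst s' ''asg'' = fst s ''asg'' \<and>
    (\<forall>c. fst s' ''out'' c = (if \<exists>r<m. c = r * K + a r then 1 else 0))" for m s'
  have "runs W (For ''i'' ''n'' out_step) s (100 * n + 10) (I n)"
  proof (rule runs_For[where I = I and N = n and T = 50])
    show "I 0 (nstore ''i'' 0 0 s)" using inst out by (simp add: I_def inst_def)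
    show "fst s ''n'' 0 = n" using inst by (simp add: inst_def)
    fix k s1 assume k: "k < n" and I: "I k s1" and ek: "fst s1 ''i'' 0 = k"
    have e: "fst s1 ''n'' 0 = n" "fst s1 ''K'' 0 = K" "snd s1 ''D'' = D" "fst s1 ''asg'' = fst s ''asg''"
      "fst s ''asg'' k = Suc (a k)"
      using I a[OF k] by (simp_all add: I_def inst_def)
    have "1 \<le> W" using W_ge n2 by linarith
    then show "runs W out_step s1 50 (\<lambda>s'. I (Suc k) (nstore ''i'' 0 (Suc k) s'))"
      unfolding out_step_def using I
      by (intro runs_intros) (auto simp: ek e I_def inst_def less_Suc_eq)
  qed (use W_ge in auto)
  then show ?thesis
  proof (rule runs_conseq)
    fix s' assume I: "I n s'"
    show "\<forall>r<n. \<forall>k<K. fst s' ''out'' (r * K + k) = (if a r = k then 1 else 0)"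
    proof (intro allI impI)
      fix r k assume rk: "r < n" "k < K"
      have dm: "(x * K + y) div K = x \<and> (x * K + y) mod K = y" if "y < K" for x y
        using that by simp
      have "(\<exists>r'<n. r * K + k = r' * K + a r') \<longleftrightarrow> a r = k"
        using rk a dm[OF rk(2), of r] dm by metis
      then show "fst s' ''out'' (r * K + k) = (if a r = k then 1 else 0)"
        using I by (simp add: I_def)
    qed
  qed simp
qed

lemma runs_assign:
  assumes inst: "inst s" and zero: "\<And>c. fst s ''out'' c = 0" "\<And>c. fst s ''T'' c = 0" "\<And>c. fst s ''asg'' c = 0"
    and pi: "\<And>c. c < K \<Longrightarrow> fst s ''pi'' c = \<pi> c" and \<pi>: "(\<Sum>c<K. \<pi> c) = n" and l: "n < 2 ^ l"
  shows "runs W assign s (3000 * (n * K * K * Suc l)) (\<lambda>s'. \<exists>a y.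
    (\<forall>r<n. a r < K) \<and> (\<forall>c<K. card {r. r < n \<and> a r = c} = \<pi> c) \<and>
    (\<forall>r<n. \<forall>k<K. d r (a r) - y (a r) \<le> d r k - y k) \<and>
    (\<forall>r<n. \<forall>k<K. fst s' ''out'' (r * K + k) = (if a r = k then 1 else 0)))"
proof -
  have J: "main_inv \<pi> m (nstore ''i'' 0 u s)" if "main_inv \<pi> m s" for m u s
    using that by (simp add: main_inv_def inst_def)
  have "forest (\<lambda>j c x. fst s ''asg'' x = Suc j) (0, 0, 0) (fst s ''T'')"
    by (simp add: forest_def zero better_def)
  then have init: "main_inv \<pi> 0 s"
    using inst pi by (simp add: main_inv_def zero dual_feasible_def)
  have "runs W (For ''i'' ''n'' phase) s (n * (phase_time l + 12) + 10) (main_inv \<pi> n)"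
  proof (rule runs_For[where I = "main_inv \<pi>" and N = n and T = "phase_time l"])
    show "fst s ''n'' 0 = n" using inst by (simp add: inst_def)
    fix i s1 assume "i < n" "main_inv \<pi> i s1" "fst s1 ''i'' 0 = i"
    then show "runs W phase s1 (phase_time l) (\<lambda>s'. main_inv \<pi> (Suc i) (nstore ''i'' 0 (Suc i) s'))"
      by (intro runs_conseq[OF runs_phase[OF _ _ _ l \<pi>]]) (auto intro: J)
  qed (use init J W_ge inst in \<open>auto simp: inst_def\<close>)
  then have "runs W assign s (n * (phase_time l + 12) + 10 + (100 * n + 10)) (\<lambda>s'. \<exists>a y.
    (\<forall>r<n. a r < K) \<and> (\<forall>c<K. card {r. r < n \<and> a r = c} = \<pi> c) \<and>
    (\<forall>r<n. \<forall>k<K. d r (a r) - y (a r) \<le> d r k - y k) \<and>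
    (\<forall>r<n. \<forall>k<K. fst s' ''out'' (r * K + k) = (if a r = k then 1 else 0)))"
    unfolding assign_def
  proof (rule runs_Seq)
    fix s1 assume inv: "main_inv \<pi> n s1" and fr: "frame (For ''i'' ''n'' phase) s s1"
    define a where "a r = fst s1 ''asg'' r - 1" for r
    have a: "fst s1 ''asg'' r = Suc (a r)" "a r < K" if "r < n" for r
    proof -
      have "fst s1 ''asg'' r \<noteq> 0" "fst s1 ''asg'' r \<le> K"
        using inv that unfolding main_inv_def by blast+
      then show "fst s1 ''asg'' r = Suc (a r)" "a r < K" by (auto simp: a_def)
    qed
    have "{x. x < n \<and> fst s1 ''asg'' x \<noteq> 0} = {..<n}" using a by auto
    moreover have "(\<Sum>c<K. card {x. x < n \<and> fst s1 ''asg'' x = Suc c}) = card {x. x < n \<and> fst s1 ''asg'' x \<noteq> 0}"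
      by (rule sum_card_columns) (use inv in \<open>auto simp: main_inv_def\<close>)
    moreover have "(\<Sum>c<K. card {x. x < n \<and> fst s1 ''asg'' x = Suc c}) + (\<Sum>c<K. fst s1 ''pi'' c) = n"
      using inv \<pi> by (simp add: main_inv_def flip: sum.distrib)
    \<comment> \<open>All \<open>n\<close> rows are placed, which exhausts the total capacity, so
      each column holds exactly its demand.\<close>
    ultimately have "(\<Sum>c<K. fst s1 ''pi'' c) = 0" by simp
    then have p0: "fst s1 ''pi'' c = 0" if "c < K" for c using that by simp
    have "{r. r < n \<and> a r = c} = {x. x < n \<and> fst s1 ''asg'' x = Suc c}" for c
      using a by auto
    then have cnt: "card {r. r < n \<and> a r = c} = \<pi> c" if "c < K" for c
    proof -
      have "card {x. x < n \<and> fst s1 ''asg'' x = Suc c} + fst s1 ''pi'' c = \<pi> c"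
        using inv that unfolding main_inv_def by blast
      then show ?thesis using p0[OF that] \<open>{r. r < n \<and> a r = c} = _\<close> by simp
    qed
    have opt: "d r (a r) - snd s1 ''y'' (a r) \<le> d r k - snd s1 ''y'' k" if "r < n" "k < K" for r k
    proof -
      have "dual_feasible (fst s1 ''asg'') (snd s1 ''y'')"
        using inv by (simp add: main_inv_def)
      then show ?thesis
        unfolding dual_feasible_def using a[OF that(1)] that by blast
    qed
    have "inst s1" using inv by (simp add: main_inv_def)
    moreover have "fst s1 ''out'' = fst s ''out''" using fr by (simp add: frame_def)
    ultimately have "runs W (For ''i'' ''n'' out_step) s1 (100 * n + 10)
      (\<lambda>s'. \<forall>r<n. \<forall>k<K. fst s' ''out'' (r * K + k) = (if a r = k then 1 else 0))"
      by (intro runs_out) (simp_all add: a zero)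
    then show "runs W (For ''i'' ''n'' out_step) s1 (100 * n + 10) (\<lambda>s'. \<exists>a y.
      (\<forall>r<n. a r < K) \<and> (\<forall>c<K. card {r. r < n \<and> a r = c} = \<pi> c) \<and>
      (\<forall>r<n. \<forall>k<K. d r (a r) - y (a r) \<le> d r k - y k) \<and>
      (\<forall>r<n. \<forall>k<K. fst s' ''out'' (r * K + k) = (if a r = k then 1 else 0)))"
    proof (rule runs_conseq)
      fix s' assume *: "\<forall>r<n. \<forall>k<K. fst s' ''out'' (r * K + k) = (if a r = k then 1 else 0)"
      show "\<exists>a y. (\<forall>r<n. a r < K) \<and> (\<forall>c<K. card {r. r < n \<and> a r = c} = \<pi> c) \<and>
        (\<forall>r<n. \<forall>k<K. d r (a r) - y (a r) \<le> d r k - y k) \<and>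
        (\<forall>r<n. \<forall>k<K. fst s' ''out'' (r * K + k) = (if a r = k then 1 else 0))"
        by (intro exI[of _ a] exI[of _ "snd s1 ''y''"]) (use a(2) cnt opt * in simp)
    qed simp
  qed simp
  moreover have "n * (phase_time l + 12) + 10 + (100 * n + 10) \<le> 3000 * (n * K * K * Suc l)"
  proof -
    have "1 * 1 * 1 \<le> K * K * Suc l" using K2 by (intro mult_le_mono) simp_all
    then have "n * 1 \<le> n * (K * K * Suc l)" by (intro mult_le_mono) simp_all
    moreover have "n * (phase_time l + 12) + 10 + (100 * n + 10) = 2000 * (n * (K * K * Suc l)) + 112 * n + 20"
      by (simp add: algebra_simps)
    ultimately show ?thesis using n2 by (simp only: mult.assoc)
  qed
  ultimately show ?thesis by (rule runs_conseq)
qed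

end

section \<open>Assignments as functions\<close>

text \<open>The map from rows to columns is the common parameter of feasible graphs and feasible
  matrices. Only its values below \<open>n\<close> are visible in either.\<close>

definition graph_of_fun :: "nat \<Rightarrow> nat \<Rightarrow> (nat \<Rightarrow> nat) \<Rightarrow> graph" where
  "graph_of_fun n K a = (Inl ` {..<n} \<union> Inr ` {..<K}, {{Inl i, Inr (a i)} |i. i < n})"

definition mat_of_fun :: "nat \<Rightarrow> nat \<Rightarrow> (nat \<Rightarrow> nat) \<Rightarrow> real mat" where
  "mat_of_fun n K a = mat n K (\<lambda>(i, k). if a i = k then 1 else 0)"

definition has_fibers :: "nat \<Rightarrow> nat \<Rightarrow> (nat \<Rightarrow> nat) \<Rightarrow> (nat \<Rightarrow> nat) \<Rightarrow> bool" where
  "has_fibers n K \<pi> a \<longleftrightarrow> (\<forall>i<n. a i < K) \<and> (\<forall>k<K. card {i. i < n \<and> a i = k} = \<pi> k)"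

lemma graph_of_fun_eq_iff: "graph_of_fun n K a = graph_of_fun n K b \<longleftrightarrow> (\<forall>i<n. a i = b i)"
proof
  assume "graph_of_fun n K a = graph_of_fun n K b"
  then have E: "{{Inl i, Inr (a i)} |i. i < n} = ({{Inl i, Inr (b i)} |i. i < n} :: vertex set set)"
    by (simp add: graph_of_fun_def)
  show "\<forall>i<n. a i = b i"
  proof (intro allI impI)
    fix i assume "i < n"
    then have "{Inl i, Inr (a i)} \<in> ({{Inl i, Inr (b i)} |i. i < n} :: vertex set set)"
      unfolding E[symmetric] by blast
    then show "a i = b i" by (auto simp: doubleton_eq_iff)
  qed
next
  assume "\<forall>i<n. a i = b i"
  then have "{{Inl i, Inr (a i)} |i. i < n} = ({{Inl i, Inr (b i)} |i. i < n} :: vertex set set)"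
    by (intro Collect_cong) auto
  then show "graph_of_fun n K a = graph_of_fun n K b"
    by (simp add: graph_of_fun_def)
qed

lemma edge_graph_of_fun: "{Inl i, Inr k} \<in> edges (graph_of_fun n K a) \<longleftrightarrow> i < n \<and> a i = k"
  by (auto simp: graph_of_fun_def edges_def doubleton_eq_iff)

lemma graph_of_mat_of_fun:
  assumes "\<forall>i<n. a i < K"
  shows "graph_of_mat (mat_of_fun n K a) = graph_of_fun n K a"
proof -
  have "{{Inl i, Inr k} |i k. i < n \<and> k < K \<and> mat_of_fun n K a $$ (i, k) = 1} = ({{Inl i, Inr (a i)} |i. i < n} :: vertex set set)"
  proof (rule Collect_cong)
    have *: "mat_of_fun n K a $$ (i, k) = 1 \<longleftrightarrow> a i = k" if "i < n" "k < K" for i k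
      using that by (simp add: mat_of_fun_def)
    fix e :: "vertex set"
    show "(\<exists>i k. e = {Inl i, Inr k} \<and> i < n \<and> k < K \<and> mat_of_fun n K a $$ (i, k) = 1) \<longleftrightarrow>
        (\<exists>i. e = {Inl i, Inr (a i)} \<and> i < n)"
      using assms * by blast
  qed
  then show ?thesis
    by (simp add: graph_of_mat_def graph_of_fun_def mat_of_fun_def)
qed

lemma degree_Inl: "i < n \<Longrightarrow> vertex_degree (graph_of_fun n K a) (Inl i) = 1"
proof -
  assume "i < n"
  then have "{e \<in> edges (graph_of_fun n K a). Inl i \<in> e} = {{Inl i, Inr (a i)}}"
    by (auto simp: graph_of_fun_def edges_def)
  then show ?thesis by (simp add: vertex_degree_def)
qed

lemma degree_Inr: "vertex_degree (graph_of_fun n K a) (Inr k) = card {i. i < n \<and> a i = k}"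
proof -
  have "{e \<in> edges (graph_of_fun n K a). Inr k \<in> e} = (\<lambda>i. {Inl i, Inr k}) ` {i. i < n \<and> a i = k}"
    by (auto simp: graph_of_fun_def edges_def)
  moreover have "inj_on (\<lambda>i. {Inl i, Inr k}) {i. i < n \<and> a i = k}"
    by (auto simp: inj_on_def doubleton_eq_iff)
  ultimately show ?thesis by (simp add: vertex_degree_def card_image)
qed

text \<open>Every edge has exactly one left endpoint, so degree 1 at \<open>Inl i\<close> singles
  out one edge and thereby \<open>a i\<close>; the degrees on the right are then the fibre sizes of
  \<open>a\<close>.\<close>

lemma assignments_iff:
  "G \<in> assignments n K \<pi> \<longleftrightarrow> (\<exists>a. has_fibers n K (($) \<pi>) a \<and> G = graph_of_fun n K a)"
proof
  assume G: "G \<in> assignments n K \<pi>"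
  then have sub: "e \<in> edges G \<Longrightarrow> \<exists>i k. e = {Inl i, Inr k} \<and> i < n \<and> k < K" for e
    by (auto simp: assignments_def is_subgraph_def complete_bip_def edges_def)
  have "\<exists>k. {e \<in> edges G. Inl i \<in> e} = {{Inl i, Inr k}} \<and> k < K" if "i < n" for i
  proof -
    have "card {e \<in> edges G. Inl i \<in> e} = 1"
      using G that by (simp add: assignments_def vertex_degree_def)
    then obtain e where e: "{e \<in> edges G. Inl i \<in> e} = {e}" by (auto simp: card_1_singleton_iff)
    then have "e \<in> edges G" "Inl i \<in> e" by auto
    with sub[of e] obtain k where "e = {Inl i, Inr k}" "k < K" by auto
    with e show ?thesis by auto
  qed
  then obtain a where a: "\<And>i. i < n \<Longrightarrow> {e \<in> edges G. Inl i \<in> e} = {{Inl i, Inr (a i)}} \<and> a i < K"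
    by metis
  have "edges G = {{Inl i, Inr (a i)} |i. i < n}"
  proof (intro equalityI subsetI)
    fix e assume e: "e \<in> edges G"
    then obtain i k where ik: "e = {Inl i, Inr k}" "i < n" using sub by blast
    then have "e \<in> {e \<in> edges G. Inl i \<in> e}" using e by simp
    then have "e = {Inl i, Inr (a i)}" using a[OF ik(2)] by simp
    with ik(2) show "e \<in> {{Inl i, Inr (a i)} |i. i < n}" by blast
  next
    fix e assume "e \<in> {{Inl i, Inr (a i)} |i. i < n}"
    then obtain i where "i < n" "e = {Inl i, Inr (a i)}" by blast
    then have "e \<in> {e \<in> edges G. Inl i \<in> e}" using a by simp
    then show "e \<in> edges G" by simp
  qed
  moreover have "verts G = Inl ` {..<n} \<union> Inr ` {..<K}" using G by (simp add: assignments_def)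
  ultimately have "G = graph_of_fun n K a"
    by (simp add: graph_of_fun_def edges_def verts_def prod_eq_iff)
  moreover have "card {i. i < n \<and> a i = k} = \<pi> $ k" if "k < K" for k
    using G that degree_Inr[of n K a k] by (simp add: assignments_def \<open>G = _\<close>)
  ultimately show "\<exists>a. has_fibers n K (($) \<pi>) a \<and> G = graph_of_fun n K a"
    using a by (auto simp: has_fibers_def)
next
  assume "\<exists>a. has_fibers n K (($) \<pi>) a \<and> G = graph_of_fun n K a"
  then obtain a where a: "has_fibers n K (($) \<pi>) a" and G: "G = graph_of_fun n K a" by blast
  have "is_subgraph G (complete_bip n K)"
    using a by (auto simp: G is_subgraph_def complete_bip_def graph_of_fun_def verts_def edges_def has_fibers_def)
  moreover have "verts G = Inl ` {..<n} \<union> Inr ` {..<K}"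
    by (simp add: G graph_of_fun_def verts_def)
  ultimately show "G \<in> assignments n K \<pi>"
    using a degree_Inl[of _ n K a] degree_Inr[of n K a] by (simp add: assignments_def G has_fibers_def)
qed

lemma cost_graph_of_fun:
  assumes "D \<in> carrier_mat n K" "\<forall>i<n. a i < K"
  shows "assignment_cost D (graph_of_fun n K a) = (\<Sum>i<n. D $$ (i, a i))"
proof -
  have "{(i, k). i < dim_row D \<and> k < dim_col D \<and> {Inl i, Inr k} \<in> edges (graph_of_fun n K a)}
      = (\<lambda>i. (i, a i)) ` {..<n}"
    using assms by (auto simp: edge_graph_of_fun)
  moreover have "inj_on (\<lambda>i. (i, a i)) {..<n}" by (auto simp: inj_on_def)
  ultimately show ?thesis by (simp add: assignment_cost_def sum.reindex)
qed

section \<open>Balanced 0-1 matrices as functions, and their distance to a given matrix\<close>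

lemma sum_zero_one:
  fixes f :: "nat \<Rightarrow> real"
  assumes "\<forall>k<K. f k \<in> {0, 1}"
  shows "(\<Sum>k<K. f k) = real (card {k. k < K \<and> f k = 1})"
proof -
  have "(\<Sum>k<K. f k) = (\<Sum>k\<in>{..<K} \<inter> {k. f k = 1}. 1)"
    unfolding sum.inter_restrict[OF finite_lessThan] by (rule sum.cong) (use assms in auto)
  also have "{..<K} \<inter> {k. f k = 1} = {k. k < K \<and> f k = 1}" by auto
  finally show ?thesis by simp
qed

lemma row_sum: "H \<in> carrier_mat n K \<Longrightarrow> i < n \<Longrightarrow> (H *\<^sub>v ones K) $ i = (\<Sum>k<K. H $$ (i, k))"
  by (simp add: ones_def scalar_prod_def lessThan_atLeast0)

lemma col_sum: "H \<in> carrier_mat n K \<Longrightarrow> k < K \<Longrightarrow> (transpose_mat H *\<^sub>v ones n) $ k = (\<Sum>i<n. H $$ (i, k))"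
  by (simp add: ones_def scalar_prod_def lessThan_atLeast0)

text \<open>With 0-1 entries, row sum 1 means a single 1 in the row, whose position is
  \<open>a i\<close>, and the column sums count the fibres of \<open>a\<close>.\<close>

lemma balanced_mats_iff:
  "H \<in> balanced_mats m K \<longleftrightarrow> (\<exists>a. has_fibers (m * K) K (\<lambda>_. m) a \<and> H = mat_of_fun (m * K) K a)"
proof
  assume "H \<in> balanced_mats m K"
  then have H: "H \<in> carrier_mat (m * K) K" and H01: "\<And>i k. i < m * K \<Longrightarrow> k < K \<Longrightarrow> H $$ (i, k) \<in> {0, 1}"
    and r: "H *\<^sub>v ones K = ones (m * K)" and c: "transpose_mat H *\<^sub>v ones (m * K) = real m \<cdot>\<^sub>v ones K"
    by (auto simp: balanced_mats_def)
  have "\<exists>k. {k. k < K \<and> H $$ (i, k) = 1} = {k}" if "i < m * K" for i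
  proof -
    have "(\<Sum>k<K. H $$ (i, k)) = 1"
      using row_sum[OF H that, unfolded r] that by (simp add: ones_def)
    then have "card {k. k < K \<and> H $$ (i, k) = 1} = 1"
      using sum_zero_one[of K "\<lambda>k. H $$ (i, k)"] H01[OF that] by simp
    then show ?thesis by (simp add: card_1_singleton_iff)
  qed
  then have "\<forall>i\<in>{..<m * K}. \<exists>k. {k. k < K \<and> H $$ (i, k) = 1} = {k}" by blast
  from bchoice[OF this] obtain a where a: "\<And>i. i < m * K \<Longrightarrow> {k. k < K \<and> H $$ (i, k) = 1} = {a i}"
    by blast
  have mem: "k < K \<and> H $$ (i, k) = 1 \<longleftrightarrow> k = a i" if "i < m * K" for i k
    using a[OF that] unfolding set_eq_iff by simp
  have aK: "a i < K" if "i < m * K" for i using mem[OF that] by blast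
  have Ha: "a i = k \<longleftrightarrow> H $$ (i, k) = 1" if "i < m * K" "k < K" for i k
    using mem[OF that(1), of k] that(2) by blast
  have "card {i. i < m * K \<and> a i = k} = m" if "k < K" for k
  proof -
    have "{i. i < m * K \<and> a i = k} = {i. i < m * K \<and> H $$ (i, k) = 1}"
      using Ha[OF _ that] by auto
    moreover have "(\<Sum>i<m * K. H $$ (i, k)) = m"
      using col_sum[OF H that, unfolded c] that by (simp add: ones_def)
    ultimately show ?thesis
      using sum_zero_one[of "m * K" "\<lambda>i. H $$ (i, k)"] H01[OF _ that] by simp
  qed
  moreover have "H = mat_of_fun (m * K) K a"
  proof (rule eq_matI)
    fix i k assume "i < dim_row (mat_of_fun (m * K) K a)" "k < dim_col (mat_of_fun (m * K) K a)"
    then have "i < m * K" "k < K" by (simp_all add: mat_of_fun_def)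
    then show "H $$ (i, k) = mat_of_fun (m * K) K a $$ (i, k)"
      using Ha[of i k] H01[of i k] by (auto simp: mat_of_fun_def)
  qed (use H in \<open>auto simp: mat_of_fun_def\<close>)
  ultimately show "\<exists>a. has_fibers (m * K) K (\<lambda>_. m) a \<and> H = mat_of_fun (m * K) K a"
    using aK by (auto simp: has_fibers_def)
next
  assume "\<exists>a. has_fibers (m * K) K (\<lambda>_. m) a \<and> H = mat_of_fun (m * K) K a"
  then obtain a where a: "has_fibers (m * K) K (\<lambda>_. m) a" and H: "H = mat_of_fun (m * K) K a" by blast
  have Hc: "H \<in> carrier_mat (m * K) K" by (simp add: H mat_of_fun_def)
  have "H *\<^sub>v ones K = ones (m * K)"
  proof (rule eq_vecI)
    fix i assume "i < dim_vec (ones (m * K))"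
    then have i: "i < m * K" by (simp add: ones_def)
    have "(\<Sum>k<K. H $$ (i, k)) = (\<Sum>k<K. if a i = k then 1 else 0)"
      by (rule sum.cong) (use i in \<open>auto simp: H mat_of_fun_def\<close>)
    also have "\<dots> = 1" using a i by (simp add: has_fibers_def)
    finally show "(H *\<^sub>v ones K) $ i = ones (m * K) $ i"
      using row_sum[OF Hc i] i by (simp add: ones_def)
  qed (use Hc in \<open>simp add: ones_def\<close>)
  moreover have "transpose_mat H *\<^sub>v ones (m * K) = real m \<cdot>\<^sub>v ones K"
  proof (rule eq_vecI)
    fix k assume "k < dim_vec (real m \<cdot>\<^sub>v ones K)"
    then have k: "k < K" by (simp add: ones_def)
    have "{i. i < m * K \<and> H $$ (i, k) = 1} = {i. i < m * K \<and> a i = k}"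
      using k by (auto simp: H mat_of_fun_def split: if_splits)
    then have "(\<Sum>i<m * K. H $$ (i, k)) = m"
      using sum_zero_one[of "m * K" "\<lambda>i. H $$ (i, k)"] a k by (simp add: has_fibers_def H mat_of_fun_def)
    then show "(transpose_mat H *\<^sub>v ones (m * K)) $ k = (real m \<cdot>\<^sub>v ones K) $ k"
      using col_sum[OF Hc k] k by (simp add: ones_def)
  qed (use Hc in \<open>simp add: ones_def\<close>)
  ultimately show "H \<in> balanced_mats m K"
    using Hc by (simp add: balanced_mats_def) (simp add: H mat_of_fun_def)
qed

text \<open>For \<open>h\<close> in {0, 1} one has (h - c)^2 = c^2 + h (1 - 2 c). Each row contains
  one 1, which yields the summand \<open>n\<close> and leaves only the cost depending on
  \<open>a\<close>.\<close>

lemma frob_norm_mat_of_fun: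
  assumes C: "C \<in> carrier_mat n K" and a: "\<forall>i<n. a i < K"
  shows "frob_norm (mat_of_fun n K a - C) = sqrt ((\<Sum>i<n. \<Sum>k<K. (C $$ (i, k))\<^sup>2) + n
    + 2 * assignment_cost (- C) (graph_of_fun n K a))"
proof -
  have row: "(\<Sum>k<K. ((mat_of_fun n K a - C) $$ (i, k))\<^sup>2) = (\<Sum>k<K. (C $$ (i, k))\<^sup>2) + (1 - 2 * C $$ (i, a i))"
    if i: "i < n" for i
  proof -
    have "(\<Sum>k<K. ((mat_of_fun n K a - C) $$ (i, k))\<^sup>2)
        = (\<Sum>k<K. (C $$ (i, k))\<^sup>2 + (if a i = k then 1 - 2 * C $$ (i, k) else 0))"
      by (rule sum.cong) (use C i in \<open>auto simp: mat_of_fun_def power2_eq_square algebra_simps\<close>)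
    also have "\<dots> = (\<Sum>k<K. (C $$ (i, k))\<^sup>2) + (1 - 2 * C $$ (i, a i))"
      using a i by (simp add: sum.distrib)
    finally show ?thesis .
  qed
  have "(\<Sum>i<n. \<Sum>k<K. ((mat_of_fun n K a - C) $$ (i, k))\<^sup>2)
      = (\<Sum>i<n. (\<Sum>k<K. (C $$ (i, k))\<^sup>2) + (1 - 2 * C $$ (i, a i)))"
    by (rule sum.cong) (use row in auto)
  also have "\<dots> = (\<Sum>i<n. \<Sum>k<K. (C $$ (i, k))\<^sup>2) + n + 2 * (\<Sum>i<n. (- C) $$ (i, a i))"
    using C a by (simp add: sum.distrib sum_subtractf sum_negf sum_distrib_left)
  also have "(\<Sum>i<n. (- C) $$ (i, a i)) = assignment_cost (- C) (graph_of_fun n K a)"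
    by (rule cost_graph_of_fun[symmetric]) (use C a in auto)
  finally show ?thesis using C by (simp add: frob_norm_def)
qed

section \<open>Transfer of minimizers between equivalent problems\<close>

lemma equivalent_min_problems_arg_min:
  assumes "equivalent_min_problems \<phi> f S g T" "x \<in> S"
  shows "is_arg_min f (\<lambda>x. x \<in> S) x \<longleftrightarrow> is_arg_min g (\<lambda>y. y \<in> T) (\<phi> x)"
proof -
  have T: "T = \<phi> ` S" using assms by (auto simp: equivalent_min_problems_def bij_betw_def)
  have "f x \<le> f y \<longleftrightarrow> g (\<phi> x) \<le> g (\<phi> y)" if "y \<in> S" for y
    using assms that by (auto simp: equivalent_min_problems_def)
  then show ?thesis
    using assms(2) unfolding is_arg_min_linorder T by auto
qed

lemma equivalent_min_problems_bij_arg_min: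
  assumes e: "equivalent_min_problems \<phi> f S g T"
  shows "bij_betw \<phi> {x. is_arg_min f (\<lambda>x. x \<in> S) x} {y. is_arg_min g (\<lambda>y. y \<in> T) y}"
proof -
  have b: "bij_betw \<phi> S T" using e by (simp add: equivalent_min_problems_def)
  have "\<phi> ` {x. is_arg_min f (\<lambda>x. x \<in> S) x} = {y. is_arg_min g (\<lambda>y. y \<in> T) y}"
  proof (intro equalityI subsetI)
    fix y assume "y \<in> \<phi> ` {x. is_arg_min f (\<lambda>x. x \<in> S) x}"
    then show "y \<in> {y. is_arg_min g (\<lambda>y. y \<in> T) y}"
      using equivalent_min_problems_arg_min[OF e] by (auto simp: is_arg_min_def)
  next
    fix y assume y: "y \<in> {y. is_arg_min g (\<lambda>y. y \<in> T) y}"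
    then have "y \<in> T" by (simp add: is_arg_min_def)
    then obtain x where "x \<in> S" "y = \<phi> x" using b by (auto simp: bij_betw_def)
    then show "y \<in> \<phi> ` {x. is_arg_min f (\<lambda>x. x \<in> S) x}"
      using equivalent_min_problems_arg_min[OF e] y by auto
  qed
  then show ?thesis
    using b by (intro bij_betw_subset[OF b]) (auto simp: is_arg_min_def)
qed

lemma projection_equivalent_assignment:
  assumes C: "C \<in> carrier_mat (m * K) K"
  shows "equivalent_min_problems graph_of_mat (\<lambda>H. frob_norm (H - C)) (balanced_mats m K)
    (assignment_cost (- C)) (assignments (m * K) K (vec K (\<lambda>_. m)))"
proof -
  let ?n = "m * K" and ?S = "balanced_mats m K" and ?T = "assignments (m * K) K (vec K (\<lambda>_. m))"
  have fib: "has_fibers ?n K (($) (vec K (\<lambda>_. m))) a \<longleftrightarrow> has_fibers ?n K (\<lambda>_. m) a" for a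
    by (auto simp: has_fibers_def)
  have g: "graph_of_mat (mat_of_fun ?n K a) = graph_of_fun ?n K a" if "has_fibers ?n K (\<lambda>_. m) a" for a
    by (rule graph_of_mat_of_fun) (use that in \<open>simp add: has_fibers_def\<close>)
  \<comment> \<open>Both feasible sets are images of the same \<open>F\<close>, so bijectivity
    follows from comparing the two parametrizations.\<close>
  define F where "F = {a. has_fibers ?n K (\<lambda>_. m) a}"
  have S: "?S = mat_of_fun ?n K ` F" unfolding F_def using balanced_mats_iff by blast
  have T: "?T = graph_of_fun ?n K ` F" unfolding F_def using assignments_iff[of _ ?n K "vec K (\<lambda>_. m)"] fib by blast
  have g: "graph_of_mat (mat_of_fun ?n K a) = graph_of_fun ?n K a" if "a \<in> F" for a
    using g that by (simp add: F_def)
  have "inj_on graph_of_mat ?S"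
  proof (rule inj_onI)
    fix H H' assume "H \<in> ?S" "H' \<in> ?S" and eq: "graph_of_mat H = graph_of_mat H'"
    then obtain a b where ab: "a \<in> F" "H = mat_of_fun ?n K a" "b \<in> F" "H' = mat_of_fun ?n K b"
      unfolding S by blast
    then have "\<forall>i<?n. a i = b i" using eq g by (simp add: graph_of_fun_eq_iff)
    then show "H = H'" unfolding ab mat_of_fun_def by (intro eq_matI) auto
  qed
  moreover have "graph_of_mat ` ?S = ?T"
    unfolding S T image_image using g by (rule image_cong[OF refl])
  moreover have "frob_norm (H - C) \<le> frob_norm (H' - C) \<longleftrightarrow>
      assignment_cost (- C) (graph_of_mat H) \<le> assignment_cost (- C) (graph_of_mat H')"
    if HH: "H \<in> ?S" "H' \<in> ?S" for H H'
  proof -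
    obtain a b where ab: "a \<in> F" "H = mat_of_fun ?n K a" "b \<in> F" "H' = mat_of_fun ?n K b"
      using HH unfolding S by blast
    then have "\<forall>i<?n. a i < K" "\<forall>i<?n. b i < K" by (simp_all add: F_def has_fibers_def)
    then show ?thesis
      using frob_norm_mat_of_fun[OF C] ab g by simp
  qed
  ultimately show ?thesis by (simp add: equivalent_min_problems_def bij_betw_def)
qed

text \<open>The potentials cancel: the sum of \<open>y (c r)\<close> over the rows depends only on
  the fibre sizes, which \<open>a\<close> and \<open>b\<close> share.\<close>

lemma dual_certificate:
  fixes d :: "nat \<Rightarrow> nat \<Rightarrow> real"
  assumes a: "has_fibers n K \<pi> a" and b: "has_fibers n K \<pi> b"
    and dual: "\<And>r k. r < n \<Longrightarrow> k < K \<Longrightarrow> d r (a r) - y (a r) \<le> d r k - y k"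
  shows "(\<Sum>r<n. d r (a r)) \<le> (\<Sum>r<n. d r (b r))"
proof -
  have fib: "(\<Sum>r<n. y (c r)) = (\<Sum>k<K. real (\<pi> k) * y k)" if c: "has_fibers n K \<pi> c" for c
  proof -
    have "(\<Sum>r<n. y (c r)) = (\<Sum>k<K. \<Sum>r\<in>{r \<in> {..<n}. c r = k}. y (c r))"
      by (rule sum.group[symmetric]) (use c in \<open>auto simp: has_fibers_def\<close>)
    also have "\<dots> = (\<Sum>k<K. real (\<pi> k) * y k)"
      using c by (intro sum.cong) (auto simp: has_fibers_def)
    finally show ?thesis .
  qed
  have "(\<Sum>r<n. d r (a r) - y (a r)) \<le> (\<Sum>r<n. d r (b r) - y (b r))"
    using b by (intro sum_mono dual) (auto simp: has_fibers_def)
  then show ?thesis by (simp add: sum_subtractf fib[OF a] fib[OF b])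
qed

lemma ex_log_bound:
  assumes "2 \<le> n"
  shows "\<exists>l. n < 2 ^ l \<and> real (Suc l) \<le> 6 * ln (real n)"
proof -
  obtain k where k: "2 ^ k \<le> n" "n < 2 ^ (k + 1)"
    using ex_power_ivl1[of 2 n] assms by auto
  have "2 ^ k \<le> real n" using k(1) by (metis of_nat_le_iff of_nat_numeral of_nat_power)
  then have "ln (2 ^ k) \<le> ln (real n)" using assms by simp
  then have "real k * ln 2 \<le> ln (real n)" by (simp add: ln_realpow)
  moreover have "1 / 2 \<le> ln (2::real)" using ln_le_minus_one[of "1/2::real"] by (simp add: ln_div)
  then have "real k * (1 / 2) \<le> real k * ln 2" by (intro mult_left_mono) auto
  moreover have "ln 2 \<le> ln (real n)" using assms by simp
  \<comment> \<open>Here \<open>l = k + 1\<close>. From \<open>1 / 2 \<le> ln 2\<close> follow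
    \<open>k \<le> 2 * ln n\<close> and \<open>2 \<le> 4 * ln n\<close>, which add up to the factor
    6.\<close>
  ultimately have "real (Suc (k + 1)) \<le> 6 * ln (real n)" using \<open>1 / 2 \<le> ln 2\<close> by simp
  with k(2) show ?thesis by blast
qed

section \<open>The projection problem and the main theorem\<close>

text \<open>Stated for any memory with the right contents instead of
  \<open>assignment_input\<close>, because \<open>project\<close> runs \<open>assign\<close> after
  preparing the arrays itself.\<close>

lemma runs_assign_optimal:
  assumes K: "2 \<le> K" "K \<le> n" and D: "D \<in> carrier_mat n K" and \<pi>: "(\<Sum>k<K. \<pi> $ k) = n" and l: "n < 2 ^ l"
    and s: "fst s ''n'' 0 = n" "fst s ''K'' 0 = K"
      "snd s ''D'' = (\<lambda>a. if a < n * K then D $$ (a div K, a mod K) else 0)"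
      "\<And>k. k < K \<Longrightarrow> fst s ''pi'' k = \<pi> $ k"
    and zero: "\<And>c. fst s ''out'' c = 0" "\<And>c. fst s ''T'' c = 0" "\<And>c. fst s ''asg'' c = 0"
  shows "runs (n ^ 4) assign s (3000 * (n * K * K * Suc l)) (\<lambda>s'. \<exists>a. has_fibers n K (($) \<pi>) a \<and>
    output_mat n K s' = mat_of_fun n K a \<and> graph_of_fun n K a \<in> min_cost_assignments D \<pi>)"
proof -
  interpret solver n K "n ^ 4" "snd s ''D''" by unfold_locales (use K in auto)
  have d: "d r k = D $$ (r, k)" if "r < n" "k < K" for r k
  proof -
    have "r * K + k < Suc r * K" using that by simp
    also have "\<dots> \<le> n * K" by (rule mult_le_mono1) (use that in simp)
    finally have "r * K + k < n * K" .
    moreover have "d r k = snd s ''D'' (r * K + k)" by (rule d_def)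
    ultimately show ?thesis using that by (simp add: s(3))
  qed
  have "inst s" unfolding inst_def using s(1,2) by blast
  from runs_assign[OF this zero s(4) \<pi> l] show ?thesis
  proof (rule runs_conseq)
    fix s' :: memory
    assume "\<exists>a y. (\<forall>r<n. a r < K) \<and> (\<forall>c<K. card {r. r < n \<and> a r = c} = \<pi> $ c) \<and>
      (\<forall>r<n. \<forall>k<K. d r (a r) - y (a r) \<le> d r k - y k) \<and>
      (\<forall>r<n. \<forall>k<K. fst s' ''out'' (r * K + k) = (if a r = k then 1 else 0))"
    then obtain a y where *: "\<forall>r<n. a r < K" "\<forall>c<K. card {r. r < n \<and> a r = c} = \<pi> $ c"
      "\<forall>r<n. \<forall>k<K. d r (a r) - y (a r) \<le> d r k - y k"
      "\<forall>r<n. \<forall>k<K. fst s' ''out'' (r * K + k) = (if a r = k then 1 else 0)"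
      by (elim exE conjE)
    have a: "has_fibers n K (($) \<pi>) a" using *(1,2) by (simp add: has_fibers_def)
    have dual: "d r (a r) - y (a r) \<le> d r k - y k" if "r < n" "k < K" for r k
      using *(3) that by blast
    have out: "fst s' ''out'' (r * K + k) = (if a r = k then 1 else 0)" if "r < n" "k < K" for r k
      using *(4) that by blast
    have "output_mat n K s' = mat_of_fun n K a"
      unfolding output_mat_def mat_of_fun_def by (rule cong_mat) (auto simp: out)
    moreover
    have cost: "assignment_cost D (graph_of_fun n K b) = (\<Sum>r<n. d r (b r))"
      if "has_fibers n K (($) \<pi>) b" for b
      using that d by (subst cost_graph_of_fun[OF D]) (auto simp: has_fibers_def)
    have opt: "(\<Sum>r<n. d r (a r)) \<le> (\<Sum>r<n. d r (b r))" if "has_fibers n K (($) \<pi>) b" for b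
      by (rule dual_certificate[where d = d and y = y, OF a that]) (rule dual)
    have "graph_of_fun n K a \<in> min_cost_assignments D \<pi>"
      unfolding min_cost_assignments_def is_arg_min_linorder carrier_matD[OF D]
      using a opt by (fastforce simp: assignments_iff cost)
    ultimately show "\<exists>a. has_fibers n K (($) \<pi>) a \<and>
      output_mat n K s' = mat_of_fun n K a \<and> graph_of_fun n K a \<in> min_cost_assignments D \<pi>"
      using a by blast
  qed simp_all
qed

text \<open>The bound 4000 accommodates both programs; 24000 is this times the factor 6 from
  \<open>ex_log_bound\<close>.\<close>

lemma time_bound:
  assumes l: "real (Suc l) \<le> 6 * ln (real n)" and t: "t \<le> 4000 * (n * K * K * Suc l)"
  shows "real t \<le> 24000 * ((real K)\<^sup>2 * real n * ln (real n))"
proof -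
  have "real t \<le> real (4000 * (n * K * K * Suc l))"
    using t by (simp only: of_nat_le_iff)
  also have "\<dots> = 4000 * ((real K)\<^sup>2 * real n * real (Suc l))"
    by (simp add: power2_eq_square algebra_simps)
  also have "\<dots> \<le> 4000 * ((real K)\<^sup>2 * real n * (6 * ln (real n)))"
    using l by (intro mult_left_mono) auto
  finally show ?thesis by simp
qed

lemma assignment_solvable:
  "assignment_solvable_in_time (\<lambda>n K. (real K)\<^sup>2 * real n * ln (real n))"
  unfolding assignment_solvable_in_time_def
proof (rule exI[of _ assign], rule exI[of _ 24000], rule exI[of _ 4], intro allI impI)
  fix K m n :: nat and D :: "real mat" and \<pi> :: "nat vec"
  assume A: "2 \<le> K" "1 \<le> m" "n = m * K" "D \<in> carrier_mat n K" "\<pi> \<in> carrier_vec K" "(\<Sum>k<K. \<pi> $ k) = n"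
  then have Kn: "K \<le> n" by simp
  then obtain l where l: "n < 2 ^ l" "real (Suc l) \<le> 6 * ln (real n)"
    using ex_log_bound[of n] A(1) by auto
  have "runs (n ^ 4) assign (assignment_input D \<pi>) (3000 * (n * K * K * Suc l)) (\<lambda>s'. \<exists>a. has_fibers n K (($) \<pi>) a \<and>
    output_mat n K s' = mat_of_fun n K a \<and> graph_of_fun n K a \<in> min_cost_assignments D \<pi>)"
    by (rule runs_assign_optimal) (use A Kn l in \<open>auto simp: assignment_input_def fun_eq_iff\<close>)
  then obtain t s a where t: "exec (n ^ 4) assign (assignment_input D \<pi>) t s" "t \<le> 3000 * (n * K * K * Suc l)"
    and a: "has_fibers n K (($) \<pi>) a" "output_mat n K s = mat_of_fun n K a"
      "graph_of_fun n K a \<in> min_cost_assignments D \<pi>"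
    unfolding runs_def by blast
  have "t \<le> 4000 * (n * K * K * Suc l)" using t(2) by linarith
  moreover have "graph_of_mat (output_mat n K s) \<in> min_cost_assignments D \<pi>"
    using a by (simp add: graph_of_mat_of_fun has_fibers_def)
  ultimately show "\<exists>t s. exec (n ^ 4) assign (assignment_input D \<pi>) t s \<and>
      real t \<le> 24000 * ((real K)\<^sup>2 * real n * ln (real n)) \<and>
      graph_of_mat (output_mat n K s) \<in> min_cost_assignments D \<pi>"
    using t(1) time_bound[OF l(2)] by blast
qed

text \<open>A loop bound must be a scalar, so the number of matrix entries is kept in
  \<open>e\<close>. Negation is subtraction from 0, as \<open>rexp\<close> has no unary
  minus.\<close>

definition project :: com where
  "project = Seq (st ''n'' (NMul (sc ''m'') (sc ''K'')))
    (Seq (st ''e'' (NMul (sc ''n'') (sc ''K'')))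
    (Seq (For ''k'' ''K'' (NStore ''pi'' (sc ''k'') (sc ''m'')))
    (Seq (For ''i'' ''e'' (RStore ''D'' (sc ''i'') (RSub (ROfNat (NConst 0)) (RRead ''C'' (sc ''i''))))) assign)))"

lemma runs_fill_pi:
  assumes "fst s ''K'' 0 = K" "fst s ''m'' 0 = m" "K \<le> W" "m \<le> W"
  shows "runs W (For ''k'' ''K'' (NStore ''pi'' (sc ''k'') (sc ''m''))) s (100 * K + 10)
    (\<lambda>s'. \<forall>k<K. fst s' ''pi'' k = m)"
proof -
  define I where "I j s' \<longleftrightarrow> fst s' ''m'' 0 = m \<and> (\<forall>k<j. fst s' ''pi'' k = m)" for j and s' :: memory
  have "runs W (For ''k'' ''K'' (NStore ''pi'' (sc ''k'') (sc ''m''))) s (100 * K + 10) (I K)"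
  proof (rule runs_For[where I = I and N = K and T = 50])
    fix j s1 assume I: "I j s1" and e: "fst s1 ''k'' 0 = j"
    have m: "fst s1 ''m'' 0 = m" using I by (simp add: I_def)
    show "runs W (NStore ''pi'' (sc ''k'') (sc ''m'')) s1 50 (\<lambda>s'. I (Suc j) (nstore ''k'' 0 (Suc j) s'))"
      using I \<open>m \<le> W\<close> by (intro runs_intros) (auto simp: I_def e m less_Suc_eq)
  qed (use assms in \<open>auto simp: I_def\<close>)
  then show ?thesis by (rule runs_conseq) (auto simp: I_def)
qed

lemma runs_negate:
  assumes "fst s ''e'' 0 = N" "snd s ''D'' = (\<lambda>_. 0)" "snd s ''C'' = C" "N \<le> W"
  shows "runs W (For ''i'' ''e'' (RStore ''D'' (sc ''i'') (RSub (ROfNat (NConst 0)) (RRead ''C'' (sc ''i''))))) s (100 * N + 10)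
    (\<lambda>s'. snd s' ''D'' = (\<lambda>a. if a < N then - C a else 0))"
proof -
  define I where "I j s' \<longleftrightarrow> snd s' ''C'' = C \<and> snd s' ''D'' = (\<lambda>a. if a < j then - C a else 0)"
    for j and s' :: memory
  have "runs W (For ''i'' ''e'' (RStore ''D'' (sc ''i'') (RSub (ROfNat (NConst 0)) (RRead ''C'' (sc ''i''))))) s (100 * N + 10) (I N)"
  proof (rule runs_For[where I = I and N = N and T = 50])
    fix j s1 assume I: "I j s1" and e: "fst s1 ''i'' 0 = j"
    have m: "snd s1 ''C'' = C" "snd s1 ''D'' = (\<lambda>a. if a < j then - C a else 0)" using I by (simp_all add: I_def)
    show "runs W (RStore ''D'' (sc ''i'') (RSub (ROfNat (NConst 0)) (RRead ''C'' (sc ''i'')))) s1 50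
        (\<lambda>s'. I (Suc j) (nstore ''i'' 0 (Suc j) s'))"
      by (intro runs_intros) (simp_all add: I_def e m fun_eq_iff less_Suc_eq)
  qed (use assms in \<open>auto simp: I_def\<close>)
  then show ?thesis by (rule runs_conseq) (auto simp: I_def)
qed

lemma runs_project:
  assumes K: "2 \<le> K" and m: "1 \<le> m" and n: "n = m * K" and C: "C \<in> carrier_mat n K" and l: "n < 2 ^ l"
  shows "runs (n ^ 4) project (projection_input m K C) (4000 * (n * K * K * Suc l)) (\<lambda>s'. \<exists>a.
    has_fibers n K (($) (vec K (\<lambda>_. m))) a \<and> output_mat n K s' = mat_of_fun n K a \<and>
    graph_of_fun n K a \<in> min_cost_assignments (- C) (vec K (\<lambda>_. m)))"
    (is "runs ?W project ?s0 _ ?Q")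
proof -
  have size: "K \<le> n" "m \<le> n" "2 \<le> n"
    using mult_le_mono[OF m order_refl[of K]] mult_le_mono[OF order_refl[of m], of 1 K] mult_le_mono[OF m K] K n by simp_all
  \<comment> \<open>Interpreted for the word bounds \<open>W_ge\<close>, which speak of sizes alone;
    the zero array is a placeholder for the costs.\<close>
  interpret solver n K ?W "\<lambda>_. 0" by unfold_locales (use K size in auto)
  have "n * K \<le> n * n" using size by simp
  then have Wb: "K \<le> ?W" "m \<le> ?W" "n \<le> ?W" "n * K \<le> ?W" using W_ge size by linarith+
  define c where "c = snd ?s0 ''C''"
  let ?s1 = "nstore ''e'' 0 (n * K) (nstore ''n'' 0 n ?s0)"
  let ?c2 = "For ''i'' ''e'' (RStore ''D'' (sc ''i'') (RSub (ROfNat (NConst 0)) (RRead ''C'' (sc ''i''))))"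
  let ?t3 = "3000 * (n * K * K * Suc l)"
  let ?t2 = "(100 * (n * K) + 10) + ?t3"
  have e0: "fst ?s0 ''m'' 0 = m" "fst ?s0 ''K'' 0 = K" "fst ?s0 ''out'' = (\<lambda>_. 0)" "fst ?s0 ''T'' = (\<lambda>_. 0)"
    "fst ?s0 ''asg'' = (\<lambda>_. 0)" "snd ?s0 ''D'' = (\<lambda>_. 0)"
    by (simp_all add: projection_input_def)
  have "runs ?W (Seq (For ''k'' ''K'' (NStore ''pi'' (sc ''k'') (sc ''m''))) (Seq ?c2 assign)) ?s1
      ((100 * K + 10) + ?t2) ?Q"
  proof (rule runs_Seq[where U = ?t2, OF runs_fill_pi], rule_tac [5] runs_Seq[where U = ?t3, OF runs_negate])
    fix s2 assume pi: "\<forall>k<K. fst s2 ''pi'' k = m" and fr: "frame (For ''k'' ''K'' (NStore ''pi'' (sc ''k'') (sc ''m''))) ?s1 s2"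
    have e2: "fst s2 ''n'' 0 = n" "fst s2 ''K'' 0 = K" "fst s2 ''e'' 0 = n * K" "fst s2 ''out'' = (\<lambda>_. 0)"
      "fst s2 ''T'' = (\<lambda>_. 0)" "fst s2 ''asg'' = (\<lambda>_. 0)" "snd s2 ''D'' = (\<lambda>_. 0)" "snd s2 ''C'' = c"
      using fr by (simp_all add: frame_def e0 c_def)
    show "fst s2 ''e'' 0 = n * K" "snd s2 ''D'' = (\<lambda>_. 0)" "snd s2 ''C'' = c" by (simp_all add: e2)
    fix s3 assume D: "snd s3 ''D'' = (\<lambda>a. if a < n * K then - c a else 0)" and fr: "frame ?c2 s2 s3"
    have e3: "fst s3 ''n'' 0 = n" "fst s3 ''K'' 0 = K" "fst s3 ''out'' = (\<lambda>_. 0)"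
      "fst s3 ''T'' = (\<lambda>_. 0)" "fst s3 ''asg'' = (\<lambda>_. 0)" "fst s3 ''pi'' = fst s2 ''pi''"
      using fr by (simp_all add: frame_def e2)
    have "- c a = (- C) $$ (a div K, a mod K)" if "a < n * K" for a
    proof -
      have "a div K < n" "a mod K < K" using that K by (auto simp: less_mult_imp_div_less)
      then show ?thesis using C that by (simp add: c_def projection_input_def n)
    qed
    then have "snd s3 ''D'' = (\<lambda>a. if a < n * K then (- C) $$ (a div K, a mod K) else 0)"
      unfolding D by auto
    then show "runs ?W assign s3 ?t3 ?Q"
      by (intro runs_assign_optimal) (use K size C l n pi in \<open>simp_all add: e3\<close>)
  qed (use Wb in \<open>simp_all add: e0\<close>)
  then have *: "runs ?W (Seq (For ''k'' ''K'' (NStore ''pi'' (sc ''k'') (sc ''m''))) (Seq ?c2 assign)) ?s1 U ?Q"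
    if "(100 * K + 10) + ?t2 \<le> U" for U
    by (rule runs_conseq) (use that in auto)
  \<comment> \<open>Naming the budget keeps the simplifier from unfolding it while the costs of the
    first stores are subtracted.\<close>
  define B where "B = 4000 * (n * K * K * Suc l)"
  have "(100 * K + 10) + ?t2 + 50 \<le> B"
  proof -
    have "1 * 1 \<le> K * Suc l" "1 * K \<le> n * K"
      by (intro mult_le_mono; use K size in simp)+
    then have "n * K * 1 \<le> n * K * (K * Suc l)" by (intro mult_le_mono) simp_all
    moreover have "n * K * K * Suc l = n * K * (K * Suc l)" by (simp only: mult.assoc)
    ultimately show ?thesis using \<open>1 * K \<le> n * K\<close> K unfolding B_def by linarith
  qed
  then have "runs ?W project ?s0 B ?Q"
    unfolding project_def
    by (intro runs_NStore_Seq) (simp_all add: e0 Wb *[simplified] flip: n)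
  then show ?thesis by (simp only: B_def)
qed

lemma projection_solvable:
  "projection_solvable_in_time (\<lambda>n K. (real K)\<^sup>2 * real n * ln (real n))"
  unfolding projection_solvable_in_time_def
proof (rule exI[of _ project], rule exI[of _ 24000], rule exI[of _ 4], intro allI impI)
  fix K m n :: nat and C :: "real mat"
  assume A: "2 \<le> K" "1 \<le> m" "n = m * K" "C \<in> carrier_mat n K"
  then have "2 \<le> n" using mult_le_mono[OF A(2,1)] by simp
  then obtain l where l: "n < 2 ^ l" "real (Suc l) \<le> 6 * ln (real n)"
    using ex_log_bound[of n] by auto
  obtain t s a where t: "exec (n ^ 4) project (projection_input m K C) t s" "t \<le> 4000 * (n * K * K * Suc l)"
    and a: "has_fibers n K (($) (vec K (\<lambda>_. m))) a" "output_mat n K s = mat_of_fun n K a"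
      "graph_of_fun n K a \<in> min_cost_assignments (- C) (vec K (\<lambda>_. m))"
    using runs_project[OF A l(1)] unfolding runs_def by blast
  have "mat_of_fun n K a \<in> balanced_mats m K"
    using a(1) unfolding balanced_mats_iff A(3) by (auto simp: has_fibers_def)
  moreover have "graph_of_mat (mat_of_fun n K a) = graph_of_fun n K a"
    by (rule graph_of_mat_of_fun) (use a(1) in \<open>simp add: has_fibers_def\<close>)
  \<comment> \<open>The output matrix is feasible and its graph is optimal, so the equivalence
    carries optimality back to the matrix.\<close>
  ultimately have "output_mat n K s \<in> projections m K C"
    using equivalent_min_problems_arg_min[OF projection_equivalent_assignment] A(3,4) a(2,3)
    by (simp add: projections_def min_cost_assignments_def)
  then show "\<exists>t s. exec (n ^ 4) project (projection_input m K C) t s \<and>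
      real t \<le> 24000 * ((real K)\<^sup>2 * real n * ln (real n)) \<and>
      output_mat n K s \<in> projections m K C"
    using t(1) time_bound[OF l(2) t(2)] by blast
qed

theorem proposition1:
  shows
    "(\<forall>(K::nat) (m::nat) n (C::real mat).
        K \<ge> 2 \<longrightarrow> m \<ge> 1 \<longrightarrow> n = m * K \<longrightarrow> C \<in> carrier_mat n K \<longrightarrow>
        (\<exists>D \<in> carrier_mat n K.
           equivalent_min_problems graph_of_mat
             (\<lambda>H. frob_norm (H - C)) (balanced_mats m K)
             (assignment_cost D) (assignments n K (vec K (\<lambda>_. m))) \<and>
           bij_betw graph_of_mat (projections m K C) (min_cost_assignments D (vec K (\<lambda>_. m))))) \<and>
     assignment_solvable_in_time (\<lambda>n K. (real K)\<^sup>2 * real n * ln (real n)) \<and>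
     projection_solvable_in_time (\<lambda>n K. (real K)\<^sup>2 * real n * ln (real n))"
proof (intro conjI allI impI assignment_solvable projection_solvable)
  fix K m n :: nat and C :: "real mat"
  assume n: "n = m * K" and C: "C \<in> carrier_mat n K"
  have e: "equivalent_min_problems graph_of_mat (\<lambda>H. frob_norm (H - C)) (balanced_mats m K)
      (assignment_cost (- C)) (assignments n K (vec K (\<lambda>_. m)))"
    using projection_equivalent_assignment C unfolding n by blast
  have "bij_betw graph_of_mat (projections m K C) (min_cost_assignments (- C) (vec K (\<lambda>_. m)))"
    using equivalent_min_problems_bij_arg_min[OF e] C
    by (simp add: projections_def min_cost_assignments_def)
  with e C show "\<exists>D \<in> carrier_mat n K.
      equivalent_min_problems graph_of_mat (\<lambda>H. frob_norm (H - C)) (balanced_mats m K)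
        (assignment_cost D) (assignments n K (vec K (\<lambda>_. m))) \<and>
      bij_betw graph_of_mat (projections m K C) (min_cost_assignments D (vec K (\<lambda>_. m)))"
    by (intro bexI[of _ "- C"]) auto
qed

end
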